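(* Let $M$ be a compact surface, possibly with boundary, endowed with a conformal class $c$ of Riemannian metrics, and let $\mu$ be a Radon probability measure on $M$. Then the first eigenvalue $\lambda_1(\mu,c)$ does not vanish if and only if there exists a positive constant $C>0$ such that the measure $\mu$ satisfies the inequality $$\mu(F)\leqslant C\cdot\operatorname{Cap}(F,\Omega)$$ for any closed subset $F\subset\Omega$ and any subdomain $\Omega\subset M$ such that $0<\mu(\Omega)\leqslant 1/2$. In particular, if a measure $\mu$ with non-vanishing $\lambda_1(\mu,c)$ is not a pure Dirac measure, then it vanishes on sets of zero capacity.
   Context: Surfaces are smooth and connected. A conformal class $c$ consists of $C^\infty$-smooth Riemannian metrics on $M$ conformal to each other; $g\in c$ is a reference metric. Radon measures are non-negative. For a Radon measure $\mu$ and an integer $k\geqslant 0$, $$\lambda_k(\mu,c)=\inf_{\Lambda^{k+1}}\ \sup_{u\in\Lambda^{k+1}\setminus\{0\}}\Big(\int_M|\nabla u|^2\,dVol_g\Big)\Big/\Big(\int_M u^2\,d\mu\Big),$$ the infimum being over all $(k+1)$-dimensional subspaces $\Lambda^{k+1}\subset L_2(M,\mu)$ formed by $C^\infty$-smooth functions on $M$ (continuous up to the boundary; no boundary condition is imposed), with $\inf\varnothing=+\infty$; this does not depend on the choice of $g\in c$. A subdomain of $M$ is an open subset $\Omega\subset M$ (open in the topology of $M$). For a compact set $F\subset\Omega$ (closed subsets $F\subset\Omega$ are understood as closed in $M$, hence compact), $$\operatorname{Cap}(F,\Omega)=\inf\Big\{\int|\nabla\varphi|^2\,dVol_g:\varphi\in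 C_0^\infty(\Omega),\ \varphi\equiv1\text{ on }F\Big\}.$$ Zero capacity is understood with respect to this (Dirichlet energy) capacity. *)

theory Defs
  imports "HOL-Probability.Probability" "HOL-Library.Function_Algebras"
begin

section \<open>Smooth maps on subsets of Euclidean space\<close>

text \<open>
  Meaningful for open \<open>S\<close>: all partial derivatives of order at most \<open>n\<close> exist and are continuous.
\<close>

primrec Ck_on :: "nat \<Rightarrow> ('e::euclidean_space \<Rightarrow> 'b::real_normed_vector) \<Rightarrow> 'e set \<Rightarrow> bool" where
  "Ck_on 0 f S \<longleftrightarrow> continuous_on S f"
| "Ck_on (Suc n) f S \<longleftrightarrow>
     (\<forall>x\<in>S. f differentiable (at x)) \<and>
     (\<forall>v. Ck_on n (\<lambda>x. frechet_derivative f (at x) v) S)"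

text \<open>
  On an arbitrary set (relatively open subsets of a half-plane, below), smooth means locally
  extendable to a \<open>C\<^sup>\<infinity>\<close> map on an open subset of the ambient space.
\<close>

definition smooth_on :: "('e::euclidean_space \<Rightarrow> 'b::real_normed_vector) \<Rightarrow> 'e set \<Rightarrow> bool" where
  "smooth_on f V \<longleftrightarrow>
     (\<forall>x\<in>V. \<exists>W F. open W \<and> x \<in> W \<and> (\<forall>n. Ck_on n F W) \<and> (\<forall>y\<in>V \<inter> W. F y = f y))"


section \<open>Surfaces with boundary\<close>

definition half_plane :: "(real^2) set" where
  "half_plane = {y. 0 \<le> y $ 2}"

text \<open>
  The surface \<open>M\<close> is the whole type \<open>'a\<close>. A chart is a domain together with a coordinate map, whose
  values outside the domain are irrelevant. The inverse of a chart \<open>(U, \<phi>)\<close> is \<open>inv_into U \<phi>\<close>.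
\<close>

type_synonym 'a chart = "'a set \<times> ('a \<Rightarrow> real^2)"

definition smooth_atlas :: "'a::topological_space chart set \<Rightarrow> bool" where
  "smooth_atlas A \<longleftrightarrow>
     (\<Union>(U, \<phi>)\<in>A. U) = UNIV \<and>
     (\<forall>(U, \<phi>)\<in>A. open U \<and> openin (top_of_set half_plane) (\<phi> ` U) \<and>
        homeomorphism U (\<phi> ` U) \<phi> (inv_into U \<phi>)) \<and>
     (\<forall>(U, \<phi>)\<in>A. \<forall>(V, \<psi>)\<in>A. smooth_on (\<psi> \<circ> inv_into U \<phi>) (\<phi> ` (U \<inter> V)))"

definition compact_surface :: "'a::t2_space chart set \<Rightarrow> bool" where
  "compact_surface A \<longleftrightarrow>
     smooth_atlas A \<and> compact (UNIV :: 'a set) \<and> connected (UNIV :: 'a set)"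

definition surface_interior :: "'a chart set \<Rightarrow> 'a set" where
  "surface_interior A = {x. \<exists>(U, \<phi>)\<in>A. x \<in> U \<and> 0 < \<phi> x $ 2}"

text \<open>
  \<open>C\<^sup>\<infinity>\<close> functions continuous up to the boundary: smooth in the interior and continuous on all of \<open>M\<close>,
  with no condition on the boundary values. All test functions below are of this kind.
\<close>

definition smooth_fun :: "'a::topological_space chart set \<Rightarrow> ('a \<Rightarrow> real) \<Rightarrow> bool" where
  "smooth_fun A u \<longleftrightarrow>
     continuous_on UNIV u \<and>
     (\<forall>(U, \<phi>)\<in>A. smooth_on (u \<circ> inv_into U \<phi>) (\<phi> ` U \<inter> {y. 0 < y $ 2}))"


section \<open>Riemannian metrics and conformal classes\<close>

text \<open>
  A metric is given by its coefficient matrices \<open>(g\<^sub>i\<^sub>j)\<close> in the charts, as functions of the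
  coordinates; \<open>\<tau>\<close> below is the transition map and the last clause is the tensor transformation law.
\<close>

type_synonym 'a metric = "'a chart \<Rightarrow> real^2 \<Rightarrow> real^2^2"

definition riemannian_metric :: "'a chart set \<Rightarrow> 'a metric \<Rightarrow> bool" where
  "riemannian_metric A g \<longleftrightarrow>
     (\<forall>(U, \<phi>)\<in>A. smooth_on (g (U, \<phi>)) (\<phi> ` U) \<and>
        (\<forall>y\<in>\<phi> ` U. transpose (g (U, \<phi>) y) = g (U, \<phi>) y \<and>
           (\<forall>v. v \<noteq> 0 \<longrightarrow> 0 < v \<bullet> (g (U, \<phi>) y *v v)))) \<and>
     (\<forall>(U, \<phi>)\<in>A. \<forall>(V, \<psi>)\<in>A. \<forall>x\<in>U \<inter> V.
        let \<tau> = \<psi> \<circ> inv_into U \<phi>;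
            J = jacobian \<tau> (at (\<phi> x) within \<phi> ` (U \<inter> V))
        in g (U, \<phi>) (\<phi> x) = transpose J ** g (V, \<psi>) (\<psi> x) ** J)"

text \<open>
  The conformal factor \<open>\<rho>\<close> is automatically smooth when \<open>g\<close> and \<open>h\<close> are Riemannian metrics.
\<close>

definition conformal_to :: "'a chart set \<Rightarrow> 'a metric \<Rightarrow> 'a metric \<Rightarrow> bool" where
  "conformal_to A g h \<longleftrightarrow>
     (\<exists>\<rho>. (\<forall>x. 0 < \<rho> x) \<and>
        (\<forall>(U, \<phi>)\<in>A. \<forall>x\<in>U. h (U, \<phi>) (\<phi> x) = \<rho> x *\<^sub>R g (U, \<phi>) (\<phi> x)))"

definition conformal_class :: "'a chart set \<Rightarrow> 'a metric set \<Rightarrow> bool" where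
  "conformal_class A c \<longleftrightarrow>
     (\<exists>g. riemannian_metric A g \<and> c = {h. riemannian_metric A h \<and> conformal_to A g h})"


section \<open>Dirichlet energy\<close>

text \<open>
  The volume measure is the unique Borel measure with density \<open>\<surd>det (g\<^sub>i\<^sub>j)\<close> in every chart.
\<close>

definition riemannian_volume :: "'a::topological_space chart set \<Rightarrow> 'a metric \<Rightarrow> 'a measure" where
  "riemannian_volume A g =
     (THE \<nu>. sets \<nu> = sets borel \<and>
        (\<forall>(U, \<phi>)\<in>A. \<forall>B\<in>sets borel. B \<subseteq> U \<longrightarrow>
           emeasure \<nu> B = (\<integral>\<^sup>+y\<in>\<phi> ` B. ennreal (sqrt (det (g (U, \<phi>) y))) \<partial>lborel)))"

text \<open>
  \<open>|\<nabla>u|\<^sup>2 = g\<^sup>i\<^sup>j \<partial>\<^sub>iu \<partial>\<^sub>ju\<close> at interior points; the value does not depend on the chart chosen.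
\<close>

definition grad_norm_sq :: "'a chart set \<Rightarrow> 'a metric \<Rightarrow> ('a \<Rightarrow> real) \<Rightarrow> 'a \<Rightarrow> real" where
  "grad_norm_sq A g u x =
     (let (U, \<phi>) = (SOME (U, \<phi>). (U, \<phi>) \<in> A \<and> x \<in> U);
          du = (\<chi> i. frechet_derivative (u \<circ> inv_into U \<phi>) (at (\<phi> x)) (axis i 1)) :: real^2
      in du \<bullet> (matrix_inv (g (U, \<phi>) (\<phi> x)) *v du))"

text \<open>
  The boundary has volume zero, so integrating over the interior loses nothing. The energy may be
  infinite, since a test function need not be differentiable at the boundary.
\<close>

definition dirichlet_energy ::
  "'a::topological_space chart set \<Rightarrow> 'a metric \<Rightarrow> ('a \<Rightarrow> real) \<Rightarrow> ennreal" where
  "dirichlet_energy A g u =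
     (\<integral>\<^sup>+x\<in>surface_interior A. ennreal (grad_norm_sq A g u x) \<partial>(riemannian_volume A g))"


section \<open>Eigenvalues of a measure\<close>

definition radon_measure :: "'a::topological_space measure \<Rightarrow> bool" where
  "radon_measure \<mu> \<longleftrightarrow>
     sets \<mu> = sets borel \<and>
     (\<forall>K. compact K \<longrightarrow> emeasure \<mu> K < \<infinity>) \<and>
     (\<forall>B\<in>sets borel. emeasure \<mu> B = (SUP K\<in>{K. compact K \<and> K \<in> sets borel \<and> K \<subseteq> B}. emeasure \<mu> K))"

global_interpretation real_fun: vector_space "\<lambda>c (u :: 'a \<Rightarrow> real) x. c * u x"
  by unfold_locales (auto simp: fun_eq_iff algebra_simps)

text \<open>
  Subspaces of \<open>L\<^sub>2(M, \<mu>)\<close> formed by smooth functions. The last clause says that the space of functions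
  \<open>\<Lambda>\<close> embeds into \<open>L\<^sub>2(M, \<mu>)\<close>, so that \<open>d\<close> is the dimension of its image there.
\<close>

definition smooth_L2_subspace ::
  "'a::topological_space chart set \<Rightarrow> 'a measure \<Rightarrow> nat \<Rightarrow> ('a \<Rightarrow> real) set \<Rightarrow> bool" where
  "smooth_L2_subspace A \<mu> d \<Lambda> \<longleftrightarrow>
     real_fun.subspace \<Lambda> \<and> real_fun.dim \<Lambda> = d \<and>
     (\<forall>u\<in>\<Lambda>. smooth_fun A u \<and> integrable \<mu> (\<lambda>x. (u x)\<^sup>2)) \<and>
     (\<forall>u\<in>\<Lambda>. (AE x in \<mu>. u x = 0) \<longrightarrow> u = 0)"

text \<open>\<open>\<lambda>\<^sub>k(\<mu>, c)\<close>, computed with the reference metric \<open>g \<in> c\<close>.\<close>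

definition eigenvalue ::
  "'a::topological_space chart set \<Rightarrow> 'a metric \<Rightarrow> 'a measure \<Rightarrow> nat \<Rightarrow> ennreal" where
  "eigenvalue A g \<mu> k =
     (INF \<Lambda>\<in>{\<Lambda>. smooth_L2_subspace A \<mu> (k + 1) \<Lambda>}. SUP u\<in>\<Lambda> - {0}.
        dirichlet_energy A g u / (\<integral>\<^sup>+x. ennreal ((u x)\<^sup>2) \<partial>\<mu>))"


section \<open>Capacity\<close>

definition capacity ::
  "'a::topological_space chart set \<Rightarrow> 'a metric \<Rightarrow> 'a set \<Rightarrow> 'a set \<Rightarrow> ennreal" where
  "capacity A g F \<Omega> =
     (INF f\<in>{f. smooth_fun A f \<and> compact (closure {x. f x \<noteq> 0}) \<and>
                closure {x. f x \<noteq> 0} \<subseteq> \<Omega> \<and> (\<forall>x\<in>F. f x = 1)}.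
        dirichlet_energy A g f)"

text \<open>
  Zero (inner) capacity is tested in all subdomains: \<open>\<Omega> = M\<close> alone would not do, since
  constants have no energy and hence \<open>Cap(F, M) = 0\<close> for every \<open>F\<close>.
\<close>

definition zero_capacity :: "'a::topological_space chart set \<Rightarrow> 'a metric \<Rightarrow> 'a set \<Rightarrow> bool" where
  "zero_capacity A g E \<longleftrightarrow>
     (\<forall>F \<Omega>. compact F \<longrightarrow> F \<subseteq> E \<longrightarrow> open \<Omega> \<longrightarrow> F \<subseteq> \<Omega> \<longrightarrow> capacity A g F \<Omega> = 0)"

end

theory Submission
  imports Defs
begin

text \<open>
  If \<open>\<lambda>\<^sub>1 > 0\<close>, testing the span of \<open>1\<close> and \<open>u\<close> gives \<open>\<lambda>\<^sub>1 Var(u) \<le> E(u)\<close>. For \<open>u\<close> equal to \<open>1\<close> on \<open>F\<close> and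
  \<open>0\<close> off \<open>\<Omega>\<close> the variance is at least \<open>\<mu>(F) (1 - \<mu>(\<Omega>))\<close>, whence
  \<open>\<lambda>\<^sub>1 \<mu>(F) (1 - \<mu>(\<Omega>)) \<le> Cap(F, \<Omega>)\<close>. This contains the capacity inequality; if \<open>E\<close> has zero capacity
  it also forces \<open>\<mu>(F) \<mu>(K) = 0\<close> for all compact \<open>F \<subseteq> E\<close> and compact \<open>K\<close> disjoint from \<open>F\<close>, so \<open>\<mu>\<close> takes
  only the values \<open>0\<close> and \<open>1\<close> on compact subsets of \<open>E\<close>, and either \<open>\<mu>(E) = 0\<close> or \<open>\<mu>\<close> is a Dirac measure.

  Conversely, every two-dimensional test space contains some \<open>u \<noteq> 0\<close> of mean zero. With \<open>m\<close> a median of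
  \<open>u\<close>, Maz'ya's truncation argument bounds the integrals of the squares of the positive and negative
  parts of \<open>u - m\<close> by the energy of \<open>u\<close>.

  Energies are only ever compared through the lower integral, so neither measurability of the gradient
  nor existence of the Riemannian volume enters.
\<close>

section \<open>Smooth functions and a cutoff\<close>

text \<open>\<open>Ck_on\<close> uses derivatives in the ambient space; as \<open>S\<close> is open,
  these depend only on the values of the function on \<open>S\<close>.\<close>

lemma Ck_on_cong:
  assumes "open S" "\<And>x. x \<in> S \<Longrightarrow> f x = g x" "Ck_on n f S"
  shows "Ck_on n g S"
  using assms(2,3)
proof (induction n arbitrary: f g)
  case 0
  then show ?case by (auto cong: continuous_on_cong)
next
  case (Suc n)
  have "g differentiable (at x)" if "x \<in> S" for x
    using Suc.prems that assms(1) has_derivative_transform_within_open[of f _ x UNIV S g]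
    unfolding differentiable_def Ck_on.simps by metis
  moreover have "Ck_on n (\<lambda>x. frechet_derivative g (at x) v) S" for v
    using Suc.IH[of "\<lambda>x. frechet_derivative f (at x) v"] Suc.prems assms(1)
      frechet_derivative_transform_within_open[of f _ S g]
    by auto
  ultimately show ?case by simp
qed

text \<open>By uniqueness of derivatives, any explicit formula \<open>D\<close> may stand in for the
  chosen \<open>frechet_derivative\<close>. The closure properties below use this to work with the
  sum, product and chain rules directly.\<close>

lemma Ck_on_Suc_intro:
  assumes "open S" "\<And>x. x \<in> S \<Longrightarrow> (f has_derivative D x) (at x)"
    and "\<And>v. Ck_on n (\<lambda>x. D x v) S"
  shows "Ck_on (Suc n) f S"
proof -
  have "Ck_on n (\<lambda>x. frechet_derivative f (at x) v) S" for v
    by (rule Ck_on_cong[OF assms(1) _ assms(3)]) (simp add: frechet_derivative_at[OF assms(2)])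
  then show ?thesis
    using assms(2) by (auto simp: differentiable_def)
qed

lemma Ck_on_Suc_has_derivative:
  "Ck_on (Suc n) f S \<Longrightarrow> x \<in> S \<Longrightarrow> (f has_derivative frechet_derivative f (at x)) (at x)"
  by (simp add: frechet_derivative_works)

lemma Ck_on_SucD: "Ck_on (Suc n) f S \<Longrightarrow> Ck_on n f S"
proof (induction n arbitrary: f)
  case 0
  then show ?case
    by (auto intro!: continuous_at_imp_continuous_on differentiable_imp_continuous_within)
next
  case (Suc n)
  have "Ck_on n (\<lambda>x. frechet_derivative f (at x) v) S" for v
    using Suc.prems by (intro Suc.IH) simp
  then show ?case
    using Suc.prems by simp
qed

lemma Ck_on_const: "Ck_on n (\<lambda>x. c) S"
  by (induction n arbitrary: c) auto

lemma Ck_on_add: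
  assumes "open S" "Ck_on n f S" "Ck_on n g S"
  shows "Ck_on n (\<lambda>x. f x + g x) S"
  using assms(2,3)
proof (induction n arbitrary: f g)
  case 0
  then show ?case by (auto intro: continuous_intros)
next
  case (Suc n)
  show ?case
  proof (rule Ck_on_Suc_intro[OF assms(1)])
    show "((\<lambda>x. f x + g x) has_derivative
        (\<lambda>v. frechet_derivative f (at x) v + frechet_derivative g (at x) v)) (at x)" if "x \<in> S" for x
      using Suc.prems that by (intro has_derivative_add Ck_on_Suc_has_derivative)
    show "Ck_on n (\<lambda>x. frechet_derivative f (at x) v + frechet_derivative g (at x) v) S" for v
      using Suc.prems by (intro Suc.IH) auto
  qed
qed

lemma Ck_on_mult:
  fixes f g :: "'e::euclidean_space \<Rightarrow> real"
  assumes "open S" "Ck_on n f S" "Ck_on n g S"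
  shows "Ck_on n (\<lambda>x. f x * g x) S"
  using assms(2,3)
proof (induction n arbitrary: f g)
  case 0
  then show ?case by (auto intro: continuous_intros)
next
  case (Suc n)
  show ?case
  proof (rule Ck_on_Suc_intro[OF assms(1)])
    show "((\<lambda>x. f x * g x) has_derivative
        (\<lambda>v. f x * frechet_derivative g (at x) v + frechet_derivative f (at x) v * g x)) (at x)"
      if "x \<in> S" for x
      using Suc.prems that by (intro has_derivative_mult Ck_on_Suc_has_derivative)
    \<comment> \<open>The product rule also contains the undifferentiated factors, so these are
      needed at the lower order too.\<close>
    have "Ck_on n f S" "Ck_on n g S"
      by (rule Ck_on_SucD[OF Suc.prems(1)], rule Ck_on_SucD[OF Suc.prems(2)])
    then show "Ck_on n (\<lambda>x. f x * frechet_derivative g (at x) v + frechet_derivative f (at x) v * g x) S" for v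
      using Suc.prems by (intro Ck_on_add[OF assms(1)] Suc.IH) auto
  qed
qed

text \<open>Induction with the chain rule: the outer function is generalised because its derivative
  takes its place in the induction hypothesis, while \<open>F\<close> stays fixed.\<close>

lemma Ck_on_compose:
  fixes \<eta> :: "real \<Rightarrow> real" and F :: "'e::euclidean_space \<Rightarrow> real"
  assumes "open W" "Ck_on n F W" "Ck_on n \<eta> UNIV"
  shows "Ck_on n (\<lambda>x. \<eta> (F x)) W"
  using assms(2,3)
proof (induction n arbitrary: \<eta>)
  case 0
  then show ?case
    using continuous_on_compose2[of UNIV \<eta> W F] by auto
next
  case (Suc n)
  let ?d = "\<lambda>t. frechet_derivative \<eta> (at t) 1"
  \<comment> \<open>A linear map on the reals is multiplication by its value at 1.\<close>
  have \<eta>: "(\<eta> has_field_derivative ?d t) (at t)" for t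
  proof -
    have \<section>: "(\<eta> has_derivative frechet_derivative \<eta> (at t)) (at t)"
      using Suc.prems by (intro Ck_on_Suc_has_derivative) auto
    then interpret bounded_linear "frechet_derivative \<eta> (at t)"
      by (rule has_derivative_bounded_linear)
    have "frechet_derivative \<eta> (at t) = (\<lambda>h. ?d t * h)"
    proof
      show "frechet_derivative \<eta> (at t) h = ?d t * h" for h
        using scaleR[of h 1] by (simp add: mult.commute)
    qed
    with \<section> show ?thesis
      by (simp add: has_field_derivative_def)
  qed
  show ?case
  proof (rule Ck_on_Suc_intro[OF assms(1)])
    show "((\<lambda>x. \<eta> (F x)) has_derivative (\<lambda>v. ?d (F x) * frechet_derivative F (at x) v)) (at x)"
      if "x \<in> W" for x
    proof -
      have "(F has_derivative frechet_derivative F (at x)) (at x)"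
        using Suc.prems that by (intro Ck_on_Suc_has_derivative) auto
      from has_derivative_compose[OF this \<eta>[of "F x", unfolded has_field_derivative_def]]
      show ?thesis .
    qed
    have "Ck_on n (\<lambda>x. ?d (F x)) W"
      using Suc.prems by (intro Suc.IH[of ?d] Ck_on_SucD[OF Suc.prems(1)]) simp
    then show "Ck_on n (\<lambda>x. ?d (F x) * frechet_derivative F (at x) v) W" for v
      using Suc.prems by (intro Ck_on_mult[OF assms(1)]) simp_all
  qed
qed

section \<open>Smooth functions of one real variable\<close>

definition Cinf_real :: "(real \<Rightarrow> real) \<Rightarrow> bool" where
  "Cinf_real \<eta> \<longleftrightarrow> (\<forall>n. Ck_on n \<eta> UNIV)"

lemma Ck_on_Suc_real:
  fixes f :: "real \<Rightarrow> real"
  assumes "\<And>x. (f has_field_derivative f' x) (at x)" "Ck_on n f' UNIV"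
  shows "Ck_on (Suc n) f UNIV"
  using assms Ck_on_mult[OF open_UNIV assms(2) Ck_on_const]
  by (intro Ck_on_Suc_intro[where D="\<lambda>x v. f' x * v"]) (auto simp: has_field_derivative_def)

lemma Cinf_real_affine: "Cinf_real (\<lambda>t. a + b * t)"
  unfolding Cinf_real_def
proof
  show "Ck_on n (\<lambda>t. a + b * t) UNIV" for n
  proof (cases n)
    case (Suc m)
    show ?thesis
      unfolding Suc
      by (rule Ck_on_Suc_real[where f'="\<lambda>_. b"]) (auto intro!: derivative_eq_intros Ck_on_const)
  qed (auto intro!: continuous_intros)
qed

lemma Cinf_real_compose: "Cinf_real \<eta> \<Longrightarrow> Cinf_real f \<Longrightarrow> Cinf_real (\<lambda>t. \<eta> (f t))"
  by (simp add: Cinf_real_def Ck_on_compose)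

text \<open>For \<open>k = 0\<close> this is the classical flat function exp(-1/t). The negative
  powers are included because the derivative of each member is a combination of members, so
  smoothness of all of them follows by one induction.\<close>

definition flat_exp :: "nat \<Rightarrow> real \<Rightarrow> real" where
  "flat_exp k t = (if t \<le> 0 then 0 else inverse t ^ k * exp (- inverse t))"

text \<open>On the right, substitute s = 1/t: the exponential beats every power of s at
  infinity.\<close>

lemma flat_exp_tendsto_0: "(flat_exp k \<longlongrightarrow> 0) (at 0)"
proof -
  have "((\<lambda>t. inverse t ^ k / exp (inverse t)) \<longlongrightarrow> (0::real)) (at_right 0)"
    using filterlim_compose[OF tendsto_power_div_exp_0 filterlim_inverse_at_top_right] .
  then have "(flat_exp k \<longlongrightarrow> 0) (at_right 0)"
    by (rule Lim_transform_eventually)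
      (auto simp: eventually_at_filter flat_exp_def exp_minus field_simps)
  moreover have "(flat_exp k \<longlongrightarrow> 0) (at_left 0)"
    by (rule Lim_transform_eventually[OF tendsto_const])
      (auto simp: eventually_at_filter flat_exp_def)
  ultimately show ?thesis
    by (simp add: filterlim_at_split)
qed

lemma flat_exp_has_derivative:
  "(flat_exp k has_field_derivative (- real k * flat_exp (Suc k) t + flat_exp (k + 2) t)) (at t)"
proof -
  consider "t < 0" | "t = 0" | "t > 0" by linarith
  then show ?thesis
  proof cases
    case 1
    have "((\<lambda>_. 0) has_field_derivative 0) (at t)" by simp
    then have "(flat_exp k has_field_derivative 0) (at t)"
      by (rule has_field_derivative_transform_within_open[where S="{..<0}"])
        (use 1 in \<open>auto simp: flat_exp_def\<close>)
    with 1 show ?thesis by (simp add: flat_exp_def)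
  next
    case 2
    \<comment> \<open>The difference quotient of \<open>flat_exp k\<close> at 0 is
      \<open>flat_exp (Suc k)\<close>, which tends to 0.\<close>
    have "((\<lambda>h. (flat_exp k (0 + h) - flat_exp k 0) / h) \<longlongrightarrow> 0) (at 0)"
      by (rule Lim_transform_eventually[OF flat_exp_tendsto_0[of "Suc k"]])
        (auto simp: eventually_at_filter flat_exp_def field_simps)
    then show ?thesis
      by (simp add: 2 DERIV_def) (simp add: flat_exp_def)
  next
    case 3
    have "((\<lambda>t. inverse t ^ k * exp (- inverse t)) has_field_derivative
        (real k * inverse t ^ (k - 1) * (- (inverse t ^ 2))) * exp (- inverse t)
        + inverse t ^ k * (exp (- inverse t) * inverse t ^ 2)) (at t)"
      using 3 by (auto intro!: derivative_eq_intros simp: power2_eq_square)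
    moreover have "(real k * inverse t ^ (k - 1) * (- (inverse t ^ 2))) * exp (- inverse t)
        + inverse t ^ k * (exp (- inverse t) * inverse t ^ 2) =
        - real k * flat_exp (Suc k) t + flat_exp (k + 2) t"
      using 3 by (cases k) (simp_all add: flat_exp_def power2_eq_square algebra_simps)
    ultimately have "((\<lambda>t. inverse t ^ k * exp (- inverse t)) has_field_derivative
        (- real k * flat_exp (Suc k) t + flat_exp (k + 2) t)) (at t)"
      by (rule DERIV_cong)
    then show ?thesis
      by (rule has_field_derivative_transform_within_open[where S="{0<..}"])
        (use 3 in \<open>auto simp: flat_exp_def\<close>)
  qed
qed

lemma Cinf_real_flat_exp: "Cinf_real (flat_exp k)"
  unfolding Cinf_real_def
proof
  show "Ck_on n (flat_exp k) UNIV" for n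
  proof (induction n arbitrary: k)
    case 0
    have "continuous_on UNIV (flat_exp k)"
      using flat_exp_has_derivative DERIV_isCont continuous_at_imp_continuous_on by blast
    then show ?case by simp
  next
    case (Suc n)
    show ?case
      by (intro Ck_on_Suc_real[OF flat_exp_has_derivative] Ck_on_add Ck_on_mult Ck_on_const Suc.IH) auto
  qed
qed

lemma smooth_cutoff:
  obtains \<eta> \<eta>' :: "real \<Rightarrow> real" and B :: real
  where "Cinf_real \<eta>" "\<And>t. (\<eta> has_field_derivative \<eta>' t) (at t)"
    "\<And>t. t \<le> 0 \<Longrightarrow> \<eta> t = 0" "\<And>t. 1 \<le> t \<Longrightarrow> \<eta> t = 1"
    "\<And>t. t \<notin> {0<..<1} \<Longrightarrow> \<eta>' t = 0" "B > 0" "\<And>t. \<bar>\<eta>' t\<bar> \<le> B"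
proof -
  define h where "h = flat_exp 0"
  define a where "a = h 1"
  have a: "a > 0" by (simp add: a_def h_def flat_exp_def)
  \<comment> \<open>For t \<le> 0 the inner value is \<open>h a\<close>, so \<eta> is 0; for t \<ge>
    1 one has h(t) \<ge> a, the inner argument is nonpositive, and \<eta> is 1. Only affine maps and
    \<open>h\<close> are composed, so smoothness is immediate.\<close>
  define \<eta> where "\<eta> t = 1 + (- 1 / h a) * h (a + (- 1) * h t)" for t
  define \<eta>' where "\<eta>' t = flat_exp 2 (a - h t) * flat_exp 2 t / h a" for t
  have ha: "h a > 0" using a by (simp add: h_def flat_exp_def)
  have h_ge: "h t \<ge> a" if "t \<ge> 1" for t
    using that by (simp add: h_def a_def flat_exp_def divide_simps)
  have h_deriv: "(h has_field_derivative flat_exp 2 t) (at t)" for t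
    using flat_exp_has_derivative[of 0 t] by (simp add: h_def numeral_2_eq_2)
  have deriv: "(\<eta> has_field_derivative \<eta>' t) (at t)" for t
    unfolding \<eta>_def \<eta>'_def
    by (rule derivative_eq_intros DERIV_chain2[OF h_deriv] h_deriv refl | simp)+
  have "Cinf_real h" by (simp add: h_def Cinf_real_flat_exp)
  then have smooth: "Cinf_real \<eta>"
    unfolding \<eta>_def
    using Cinf_real_compose[OF Cinf_real_affine Cinf_real_compose[OF _ Cinf_real_compose[OF Cinf_real_affine]]]
    by blast
  have outside: "\<eta>' t = 0" if "t \<notin> {0<..<1}" for t
    using that h_ge[of t] by (cases "t \<le> 0") (auto simp: \<eta>'_def flat_exp_def)
  have cont: "continuous_on UNIV (flat_exp k)" for k
    using Cinf_real_flat_exp[of k, unfolded Cinf_real_def, rule_format, of 0] by simp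
  have "continuous_on {0..1} \<eta>'"
    unfolding \<eta>'_def h_def
    by (intro continuous_intros continuous_on_compose2[OF cont] continuous_on_subset[OF cont])
      (use ha in \<open>auto simp: h_def\<close>)
  then have "bounded (\<eta>' ` {0..1})"
    using compact_continuous_image compact_imp_bounded compact_Icc by blast
  then obtain B where B: "\<And>t. t \<in> {0..1} \<Longrightarrow> \<bar>\<eta>' t\<bar> \<le> B"
    unfolding bounded_iff real_norm_def by blast
  \<comment> \<open>Compactness of the unit interval bounds the derivative there, and it vanishes
    elsewhere; the maximum with 1 makes the bound positive.\<close>
  have bound: "\<bar>\<eta>' t\<bar> \<le> max B 1" for t
    using B[of t] outside[of t] by (cases "t \<in> {0<..<1}") auto
  show ?thesis
  proof (rule that[OF smooth deriv _ _ outside _ bound])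
    show "\<eta> t = 0" if "t \<le> 0" for t
      using that ha by (simp add: \<eta>_def h_def flat_exp_def)
    show "\<eta> t = 1" if "1 \<le> t" for t
      using h_ge[OF that] by (simp add: \<eta>_def h_def flat_exp_def)
  qed auto
qed

section \<open>Composition and the Dirichlet energy\<close>

lemma smooth_onE:
  assumes "smooth_on f V" "x \<in> V"
  obtains W F where "open W" "x \<in> W" "\<And>n. Ck_on n F W" "\<And>y. y \<in> V \<inter> W \<Longrightarrow> F y = f y"
  using bspec[OF assms(1)[unfolded smooth_on_def] assms(2)] by blast

lemma smooth_atlasD:
  assumes "smooth_atlas A" "(U, \<phi>) \<in> A"
  shows "open U" "openin (top_of_set half_plane) (\<phi> ` U)"
    "homeomorphism U (\<phi> ` U) \<phi> (inv_into U \<phi>)"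
  using assms by (auto simp: smooth_atlas_def)

lemma smooth_fun_compose:
  assumes u: "smooth_fun A u" and \<eta>: "Cinf_real \<eta>"
  shows "smooth_fun A (\<lambda>x. \<eta> (u x))"
  unfolding smooth_fun_def
proof (intro conjI ballI)
  have "continuous_on UNIV \<eta>"
    using \<eta>[unfolded Cinf_real_def, rule_format, of 0] by simp
  then show "continuous_on UNIV (\<lambda>x. \<eta> (u x))"
    using u unfolding smooth_fun_def by (auto intro: continuous_on_compose2)
  fix p assume p: "p \<in> A"
  obtain U \<phi> where [simp]: "p = (U, \<phi>)" by force
  let ?V = "\<phi> ` U \<inter> {y. 0 < y $ 2}"
  have "smooth_on (u \<circ> inv_into U \<phi>) ?V"
    using u p by (auto simp: smooth_fun_def)
  then have "\<exists>W F. open W \<and> x \<in> W \<and> (\<forall>n. Ck_on n F W) \<and>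
      (\<forall>y\<in>?V \<inter> W. F y = ((\<lambda>x. \<eta> (u x)) \<circ> inv_into U \<phi>) y)" if xV: "x \<in> ?V" for x
  proof -
    obtain W F where W: "open W" "x \<in> W" and F: "\<And>n. Ck_on n F W"
      "\<And>y. y \<in> ?V \<inter> W \<Longrightarrow> F y = (u \<circ> inv_into U \<phi>) y"
      using \<open>smooth_on (u \<circ> inv_into U \<phi>) ?V\<close> xV by (rule smooth_onE) (rule that)
    have "Ck_on n (\<lambda>y. \<eta> (F y)) W" for n
      using Ck_on_compose[OF W(1) F(1)] \<eta> by (auto simp: Cinf_real_def)
    with W F(2) show ?thesis
      by (intro exI[of _ W] exI[of _ "\<lambda>y. \<eta> (F y)"]) auto
  qed
  then have "smooth_on ((\<lambda>x. \<eta> (u x)) \<circ> inv_into U \<phi>) ?V"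
    unfolding smooth_on_def by blast
  then show "case p of (U, \<phi>) \<Rightarrow> smooth_on ((\<lambda>x. \<eta> (u x)) \<circ> inv_into U \<phi>) (\<phi> ` U \<inter> {y. 0 < y $ 2})"
    by simp
qed

text \<open>Chart images are only relatively open in the half-plane; removing the boundary line
  makes them open in the plane, where ambient derivatives make sense.\<close>

lemma open_chart_interior_image:
  assumes "smooth_atlas A" "(U, \<phi>) \<in> A" "open V"
  shows "open (\<phi> ` (U \<inter> V) \<inter> {y. 0 < y $ 2})"
proof -
  have hom: "homeomorphism U (\<phi> ` U) \<phi> (inv_into U \<phi>)"
    and op: "openin (top_of_set half_plane) (\<phi> ` U)"
    using smooth_atlasD[OF assms(1,2)] by auto
  have "openin (top_of_set (\<phi> ` U)) (\<phi> ` (U \<inter> V))"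
    using homeomorphism_imp_open_map[OF hom] assms(3) by (auto simp: openin_open)
  then have "openin (top_of_set half_plane) (\<phi> ` (U \<inter> V))"
    using op openin_trans by blast
  then obtain T where T: "open T" "\<phi> ` (U \<inter> V) = half_plane \<inter> T"
    by (auto simp: openin_open)
  then have "\<phi> ` (U \<inter> V) \<inter> {y. 0 < y $ 2} = T \<inter> {y. 0 < y $ 2}"
    by (auto simp: half_plane_def)
  moreover have "open {y::real^2. 0 < y $ 2}"
    by (intro open_Collect_less continuous_intros)
  ultimately show ?thesis
    using T(1) by (metis open_Int)
qed

text \<open>Invariance of domain, applied to the transition map.\<close>

lemma surface_interior_chart:
  assumes A: "smooth_atlas A" and x: "x \<in> surface_interior A" and V: "(V, \<psi>) \<in> A" "x \<in> V"
  shows "0 < \<psi> x $ 2"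
proof -
  obtain U \<phi> where U: "(U, \<phi>) \<in> A" "x \<in> U" "0 < \<phi> x $ 2"
    using x by (auto simp: surface_interior_def)
  let ?S = "\<phi> ` (U \<inter> V) \<inter> {y. 0 < y $ 2}"
  let ?\<tau> = "\<psi> \<circ> inv_into U \<phi>"
  have homU: "homeomorphism U (\<phi> ` U) \<phi> (inv_into U \<phi>)" and homV: "homeomorphism V (\<psi> ` V) \<psi> (inv_into V \<psi>)"
    and half: "\<psi> ` V \<subseteq> half_plane" and "open V"
    using smooth_atlasD[OF A U(1)] smooth_atlasD[OF A V(1)] openin_imp_subset by blast+
  have inv: "inv_into U \<phi> (\<phi> y) = y" if "y \<in> U" for y
    using homU that by (simp add: homeomorphism_def)
  have "open ?S"
    using open_chart_interior_image[OF A U(1) \<open>open V\<close>] .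
  moreover have "continuous_on ?S ?\<tau>"
  proof (rule continuous_on_compose)
    show "continuous_on ?S (inv_into U \<phi>)"
      using homU by (auto simp: homeomorphism_def intro: continuous_on_subset)
    show "continuous_on (inv_into U \<phi> ` ?S) \<psi>"
      using homV inv by (auto simp: homeomorphism_def intro!: continuous_on_subset[of V \<psi>])
  qed
  moreover have "inj_on ?\<tau> ?S"
  proof -
    have "a = b" if "\<psi> a = \<psi> b" "a \<in> V" "b \<in> V" for a b
      using homV that unfolding homeomorphism_def by metis
    then show ?thesis
      by (intro inj_onI) (clarsimp simp: inv, rule arg_cong, blast)
  qed
  ultimately have "open (?\<tau> ` ?S)"
    using invariance_of_domain by blast
  moreover have "\<psi> x \<in> ?\<tau> ` ?S"
    using U V inv by (force intro!: image_eqI[where x="\<phi> x"])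
  ultimately obtain e where e: "e > 0" "ball (\<psi> x) e \<subseteq> ?\<tau> ` ?S"
    by (meson open_contains_ball)
  \<comment> \<open>A point below \<psi>(x) by less than the radius \<open>e\<close>. It still lies
    in the image of the transition map, hence in the half-plane, which forces \<psi>(x) off the
    boundary line.\<close>
  define z where "z = \<psi> x - (e / 2) *\<^sub>R axis 2 1"
  have "z \<in> ball (\<psi> x) e"
    using e by (simp add: z_def dist_norm norm_axis_1)
  then have "z \<in> ?\<tau> ` ?S"
    using e by blast
  also have "?\<tau> ` ?S \<subseteq> half_plane"
    using half inv by auto
  finally have "z \<in> half_plane" .
  then have "0 \<le> \<psi> x $ 2 - e / 2"
    by (simp add: half_plane_def z_def axis_def)
  with e show ?thesis by simp
qed

text \<open>\<open>smooth_on\<close> provides a local extension \<open>F\<close>. Near an interior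
  point it agrees with the coordinate expression on an open set, so its derivative carries
  over.\<close>

lemma smooth_fun_has_derivative:
  assumes A: "smooth_atlas A" and u: "smooth_fun A u" and U: "(U, \<phi>) \<in> A" "x \<in> U" "0 < \<phi> x $ 2"
  shows "(u \<circ> inv_into U \<phi> has_derivative frechet_derivative (u \<circ> inv_into U \<phi>) (at (\<phi> x))) (at (\<phi> x))"
proof -
  let ?V = "\<phi> ` U \<inter> {y. 0 < y $ 2}"
  have "smooth_on (u \<circ> inv_into U \<phi>) ?V" "\<phi> x \<in> ?V"
    using u U by (auto simp: smooth_fun_def)
  then obtain W F where W: "open W" "\<phi> x \<in> W" and F: "\<And>n. Ck_on n F W"
    "\<And>y. y \<in> ?V \<inter> W \<Longrightarrow> F y = (u \<circ> inv_into U \<phi>) y"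
    by (rule smooth_onE) (rule that)
  have V: "open (?V \<inter> W)"
    using open_chart_interior_image[OF A U(1), of UNIV] W(1) by auto
  have "(F has_derivative frechet_derivative F (at (\<phi> x))) (at (\<phi> x))"
    using Ck_on_Suc_has_derivative[OF F(1) W(2)] .
  then have "(u \<circ> inv_into U \<phi> has_derivative frechet_derivative F (at (\<phi> x))) (at (\<phi> x))"
    by (rule has_derivative_transform_within_open[OF _ V]) (use F(2) U W(2) in auto)
  then show ?thesis
    using frechet_derivative_works differentiable_def by blast
qed

text \<open>The chain rule multiplies the differential by \<eta>'(u x), and the squared gradient
  norm is quadratic in the differential.\<close>

lemma grad_norm_sq_compose:
  assumes A: "smooth_atlas A" and u: "smooth_fun A u" and x: "x \<in> surface_interior A"
    and \<eta>: "\<And>t. (\<eta> has_field_derivative \<eta>' t) (at t)"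
  shows "grad_norm_sq A g (\<lambda>x. \<eta> (u x)) x = (\<eta>' (u x))\<^sup>2 * grad_norm_sq A g u x"
proof -
  \<comment> \<open>The chart picked by \<open>grad_norm_sq\<close> depends on the point only, so
    both sides are computed in the same chart.\<close>
  define p where "p = (SOME (U, \<phi>). (U, \<phi>) \<in> A \<and> x \<in> U)"
  obtain U \<phi> where p: "p = (U, \<phi>)" by force
  have "\<exists>p. (case p of (U, \<phi>) \<Rightarrow> (U, \<phi>) \<in> A \<and> x \<in> U)"
    using x by (auto simp: surface_interior_def)
  from someI_ex[OF this] have U: "(U, \<phi>) \<in> A" "x \<in> U"
    unfolding p_def[symmetric] p by auto
  let ?f = "u \<circ> inv_into U \<phi>"
  have inv: "inv_into U \<phi> (\<phi> x) = x"
    using smooth_atlasD(3)[OF A U(1)] U(2) by (simp add: homeomorphism_def)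
  have "(?f has_derivative frechet_derivative ?f (at (\<phi> x))) (at (\<phi> x))"
    using smooth_fun_has_derivative[OF A u U surface_interior_chart[OF A x U]] .
  from has_derivative_compose[OF this \<eta>[of "?f (\<phi> x)", unfolded has_field_derivative_def]]
  have "(((\<lambda>x. \<eta> (u x)) \<circ> inv_into U \<phi>) has_derivative
      (\<lambda>v. \<eta>' (u x) * frechet_derivative ?f (at (\<phi> x)) v)) (at (\<phi> x))"
    by (simp add: o_def inv)
  then have D: "frechet_derivative ((\<lambda>x. \<eta> (u x)) \<circ> inv_into U \<phi>) (at (\<phi> x)) =
      (\<lambda>v. \<eta>' (u x) * frechet_derivative ?f (at (\<phi> x)) v)"
    using frechet_derivative_at by metis
  have "(\<chi> i. c * d i) = c *\<^sub>R (\<chi> i. d i)" for c and d :: "2 \<Rightarrow> real"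
    by (simp add: vec_eq_iff)
  then show ?thesis
    unfolding grad_norm_sq_def Let_def p_def[symmetric] p
    by (simp add: D matrix_vector_mult_scaleR power2_eq_square)
qed

lemma dirichlet_energy_compose:
  assumes "smooth_atlas A" "smooth_fun A u" "\<And>t. (\<eta> has_field_derivative \<eta>' t) (at t)"
  shows "dirichlet_energy A g (\<lambda>x. \<eta> (u x)) =
    (\<integral>\<^sup>+x\<in>surface_interior A. ennreal ((\<eta>' (u x))\<^sup>2) * ennreal (grad_norm_sq A g u x) \<partial>(riemannian_volume A g))"
  unfolding dirichlet_energy_def
  using assms by (intro nn_integral_cong)
    (auto simp: grad_norm_sq_compose[OF assms(1,2) _ assms(3)] indicator_def simp flip: ennreal_mult')

section \<open>Lower integrals of arbitrary functions\<close>

text \<open>\<open>nn_integral\<close> is the supremum of the integrals of simple minorants, and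
  minorants of \<open>f\<close> and \<open>g\<close> add up to a minorant of the sum.\<close>

lemma nn_integral_superadditive:
  "(\<integral>\<^sup>+x. f x \<partial>M) + (\<integral>\<^sup>+x. g x \<partial>M) \<le> (\<integral>\<^sup>+x. f x + g x \<partial>M)"
proof -
  let ?S = "\<lambda>f. {s. simple_function M s \<and> s \<le> f}"
  have ne: "?S f \<noteq> {}" for f :: "_ \<Rightarrow> ennreal"
    by (auto simp: le_fun_def intro!: exI[of _ "\<lambda>_. 0"])
  have step: "integral\<^sup>S M s + integral\<^sup>S M t \<le> (\<integral>\<^sup>+x. f x + g x \<partial>M)"
    if "s \<in> ?S f" "t \<in> ?S g" for s t
  proof -
    have "integral\<^sup>S M s + integral\<^sup>S M t = (\<integral>\<^sup>Sx. s x + t x \<partial>M)"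
      using that by (simp add: simple_integral_add)
    also have "\<dots> \<le> (\<integral>\<^sup>+x. f x + g x \<partial>M)"
      unfolding nn_integral_def using that
      by (intro SUP_upper) (auto simp: le_fun_def intro!: add_mono)
    finally show ?thesis .
  qed
  have "integral\<^sup>S M s + (\<integral>\<^sup>+x. g x \<partial>M) \<le> (\<integral>\<^sup>+x. f x + g x \<partial>M)" if "s \<in> ?S f" for s
    unfolding nn_integral_def[of M g]
    by (subst ennreal_SUP_add_right[OF ne]) (rule SUP_least[OF step[OF that]])
  then show ?thesis
    unfolding nn_integral_def[of M f]
    by (subst ennreal_SUP_add_left[OF ne, symmetric]) (rule SUP_least)
qed

text \<open>Used to add up the energies on disjoint layers: together they do not exceed the total
  energy.\<close>

lemma nn_integral_suminf_superadditive:
  fixes f :: "nat \<Rightarrow> 'a \<Rightarrow> ennreal"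
  shows "(\<Sum>i. \<integral>\<^sup>+x. f i x \<partial>M) \<le> (\<integral>\<^sup>+x. (\<Sum>i. f i x) \<partial>M)"
  unfolding suminf_eq_SUP[of "\<lambda>i. \<integral>\<^sup>+x. f i x \<partial>M"]
proof (rule SUP_least)
  fix n
  have "(\<Sum>i<n. \<integral>\<^sup>+x. f i x \<partial>M) \<le> (\<integral>\<^sup>+x. (\<Sum>i<n. f i x) \<partial>M)"
  proof (induction n)
    case (Suc n)
    then show ?case
      using nn_integral_superadditive[of M "\<lambda>x. \<Sum>i<n. f i x" "f n"]
      by (auto intro: order_trans add_right_mono)
  qed simp
  also have "\<dots> \<le> (\<integral>\<^sup>+x. (\<Sum>i. f i x) \<partial>M)"
    by (intro nn_integral_mono sum_le_suminf) auto
  finally show "(\<Sum>i<n. \<integral>\<^sup>+x. f i x \<partial>M) \<le> (\<integral>\<^sup>+x. (\<Sum>i. f i x) \<partial>M)" .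
qed

text \<open>Dividing a simple minorant of c f by c > 0 yields a simple minorant of f.\<close>

lemma nn_integral_cmult_le:
  fixes f :: "'a \<Rightarrow> ennreal"
  assumes "0 < c"
  shows "(\<integral>\<^sup>+x. ennreal c * f x \<partial>M) \<le> ennreal c * (\<integral>\<^sup>+x. f x \<partial>M)"
  unfolding nn_integral_def[of M "\<lambda>x. ennreal c * f x"]
proof (rule SUP_least)
  fix s assume s: "s \<in> {s. simple_function M s \<and> s \<le> (\<lambda>x. ennreal c * f x)}"
  define t where "t x = ennreal (1 / c) * s x" for x
  have st: "s x = ennreal c * t x" for x
    using assms by (simp add: t_def mult.assoc[symmetric] flip: ennreal_mult')
  have "simple_function M t"
    unfolding t_def using s by auto
  moreover have "t x \<le> f x" for x
  proof -
    have "t x \<le> ennreal (1 / c) * (ennreal c * f x)"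
      unfolding t_def using s by (intro mult_left_mono) (auto simp: le_fun_def)
    also have "\<dots> = f x"
      using assms by (simp add: mult.assoc[symmetric] flip: ennreal_mult')
    finally show ?thesis .
  qed
  ultimately have "integral\<^sup>S M t \<le> (\<integral>\<^sup>+x. f x \<partial>M)"
    unfolding nn_integral_def by (intro SUP_upper) (auto simp: le_fun_def)
  moreover have "integral\<^sup>S M s = ennreal c * integral\<^sup>S M t"
    using simple_integral_mult[OF \<open>simple_function M t\<close>] by (simp add: st[abs_def])
  ultimately show "integral\<^sup>S M s \<le> ennreal c * (\<integral>\<^sup>+x. f x \<partial>M)"
    by (simp add: mult_left_mono)
qed

lemma dirichlet_energy_affine_le:
  assumes "smooth_atlas A" "smooth_fun A u"
  shows "dirichlet_energy A g (\<lambda>x. a + b * u x) \<le> ennreal (b\<^sup>2) * dirichlet_energy A g u"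
proof (cases "b = 0")
  case True
  then show ?thesis
    using dirichlet_energy_compose[OF assms, of "\<lambda>t. a" "\<lambda>t. 0" g] by simp
next
  case False
  then have "0 < b\<^sup>2" by simp
  have "((\<lambda>t. a + b * t) has_field_derivative b) (at t)" for t
    by (auto intro!: derivative_eq_intros)
  from dirichlet_energy_compose[OF assms this, of g] show ?thesis
    unfolding dirichlet_energy_def[of _ _ u]
    using nn_integral_cmult_le[OF \<open>0 < b\<^sup>2\<close>] by (simp add: mult.assoc)
qed

section \<open>Eigenvalues and capacities\<close>

locale surface_probability = prob_space \<mu>
  for \<mu> :: "'a::t2_space measure" +
  fixes A :: "'a chart set" and g :: "'a metric"
  assumes atlas: "smooth_atlas A"
    and compact_UNIV: "compact (UNIV :: 'a set)"
    and sets_\<mu>: "sets \<mu> = sets borel"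
begin

lemma space_\<mu>: "space \<mu> = UNIV"
  using sets_eq_imp_space_eq[OF sets_\<mu>] by simp

lemma smooth_fun_continuous: "smooth_fun A u \<Longrightarrow> continuous_on UNIV u"
  by (simp add: smooth_fun_def)

lemma smooth_fun_measurable: "smooth_fun A u \<Longrightarrow> u \<in> borel_measurable \<mu>"
  using borel_measurable_continuous_onI[OF smooth_fun_continuous]
  by (simp add: measurable_cong_sets[OF sets_\<mu> refl])

lemma smooth_fun_bounded:
  assumes "smooth_fun A u"
  obtains R where "R > 0" "\<And>x. \<bar>u x\<bar> \<le> R"
proof -
  have "bounded (range u)"
    using compact_continuous_image[OF smooth_fun_continuous[OF assms] compact_UNIV] compact_imp_bounded by blast
  then obtain R where "\<And>x. \<bar>u x\<bar> \<le> R"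
    unfolding bounded_iff real_norm_def by blast
  then have "\<bar>u x\<bar> \<le> max R 1" for x
    by (meson max.coboundedI1)
  then show thesis by (rule that[rotated]) simp
qed

lemma smooth_fun_integrable:
  assumes "smooth_fun A u"
  shows "integrable \<mu> u" "integrable \<mu> (\<lambda>x. (u x)\<^sup>2)"
proof -
  obtain R where R: "R > 0" "\<And>x. \<bar>u x\<bar> \<le> R"
    by (rule smooth_fun_bounded[OF assms]) (rule that)
  note [measurable] = smooth_fun_measurable[OF assms]
  show "integrable \<mu> u"
    by (rule integrable_const_bound[where B=R]) (use R in auto)
  have "(u x)\<^sup>2 \<le> R\<^sup>2" for x
    using R power_mono[OF R(2)[of x] abs_ge_zero, of 2] by simp
  then show "integrable \<mu> (\<lambda>x. (u x)\<^sup>2)"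
    by (intro integrable_const_bound[where B="R\<^sup>2"]) auto
qed

text \<open>Second moment as variance plus squared mean. It serves both to compute norms in the span
  of 1 and \<open>u\<close> and to compare deviations from the mean and from a median.\<close>

lemma expectation_affine_sq:
  assumes "smooth_fun A u"
  shows "expectation (\<lambda>x. (a + b * u x)\<^sup>2) = b\<^sup>2 * variance u + (a + b * expectation u)\<^sup>2"
proof -
  note int = smooth_fun_integrable[OF assms]
  have "expectation (\<lambda>x. (a + b * u x)\<^sup>2) =
      expectation (\<lambda>x. a\<^sup>2 + (2 * a * b) * u x + b\<^sup>2 * (u x)\<^sup>2)"
    by (rule Bochner_Integration.integral_cong) (auto simp: power2_eq_square algebra_simps)
  also have "\<dots> = a\<^sup>2 + (2 * a * b) * expectation u + b\<^sup>2 * expectation (\<lambda>x. (u x)\<^sup>2)"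
    using int by (simp add: prob_space)
  also have "\<dots> = b\<^sup>2 * (S - m\<^sup>2) + (a + b * m)\<^sup>2"
    if "S = expectation (\<lambda>x. (u x)\<^sup>2)" "m = expectation u" for S m
    unfolding that[symmetric] by (simp add: power2_eq_square algebra_simps)
  finally show ?thesis
    unfolding variance_eq[OF int] by blast
qed

lemma smooth_fun_affine: "smooth_fun A u \<Longrightarrow> smooth_fun A (\<lambda>x. a + b * u x)"
  using smooth_fun_compose[OF _ Cinf_real_affine] .

lemma nn_integral_sq:
  assumes "smooth_fun A u"
  shows "(\<integral>\<^sup>+x. ennreal ((u x)\<^sup>2) \<partial>\<mu>) = ennreal (expectation (\<lambda>x. (u x)\<^sup>2))"
  using smooth_fun_integrable(2)[OF assms] by (intro nn_integral_eq_integral) auto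

lemma mem_span_one_iff:
  "w \<in> real_fun.span {\<lambda>_. 1, u} \<longleftrightarrow> (\<exists>a b. w = (\<lambda>x. a + b * u x))" for u :: "'a \<Rightarrow> real"
proof -
  have "w \<in> real_fun.span {\<lambda>_. 1, u} \<longleftrightarrow> (\<exists>a b. w - (\<lambda>x. a * 1) = (\<lambda>x. b * u x))"
    unfolding real_fun.span_breakdown_eq[of w "\<lambda>_. 1"] real_fun.span_singleton by auto
  also have "\<dots> \<longleftrightarrow> (\<exists>a b. w = (\<lambda>x. a + b * u x))"
    by (auto simp: fun_eq_iff algebra_simps)
  finally show ?thesis .
qed

text \<open>The test space is the span of \<open>1\<close> and \<open>u\<close>; the worst quotient in it is that of \<open>u\<close> minus its mean.\<close>

lemma eigenvalue_mult_variance_le: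
  assumes u: "smooth_fun A u"
  shows "eigenvalue A g \<mu> 1 * ennreal (variance u) \<le> dirichlet_energy A g u"
proof (cases "variance u = 0")
  case False
  define V where "V = variance u"
  have "V \<ge> 0"
    unfolding V_def by (rule Bochner_Integration.integral_nonneg) simp
  with False have V: "V > 0"
    unfolding V_def less_le by simp
  define \<Lambda> where "\<Lambda> = real_fun.span {\<lambda>_. 1, u}"
  have not_const: "u \<noteq> (\<lambda>_. c)" for c
    using False by (auto simp: prob_space)
  have sq: "(\<integral>\<^sup>+x. ennreal ((a + b * u x)\<^sup>2) \<partial>\<mu>) = ennreal (b\<^sup>2 * V + (a + b * expectation u)\<^sup>2)" for a b
    using nn_integral_sq[OF smooth_fun_affine[OF u]] expectation_affine_sq[OF u] by (simp add: V_def)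
  \<comment> \<open>As V > 0, the squared norm of a + b u vanishes only for a = b = 0: this gives
    the embedding into L2 and nonzero denominators.\<close>
  have zero: "a = 0 \<and> b = 0" if "b\<^sup>2 * V + (a + b * expectation u)\<^sup>2 \<le> 0" for a b
  proof -
    have "b\<^sup>2 * V \<ge> 0" "(a + b * expectation u)\<^sup>2 \<ge> 0"
      using V by auto
    with that have "b\<^sup>2 * V = 0 \<and> (a + b * expectation u)\<^sup>2 = 0"
      by linarith
    with V show ?thesis by auto
  qed
  have indep: "\<not> real_fun.dependent {\<lambda>_. 1, u}"
  proof -
    have "(\<lambda>_. 1) \<notin> real_fun.span {u}"
    proof
      assume "(\<lambda>_. 1) \<in> real_fun.span {u}"
      then obtain k where k: "(\<lambda>_. 1) = (\<lambda>x. k * u x)"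
        by (auto simp: real_fun.span_singleton)
      then have "u = (\<lambda>_. 1 / k)"
        by (metis (no_types, lifting) divide_eq_eq_1 eq_divide_eq mult.commute mult_zero_left zero_neq_one)
      with not_const show False by blast
    qed
    moreover have "u \<noteq> 0"
      using not_const[of 0] by (simp add: zero_fun_def)
    ultimately show ?thesis
      using not_const[of 1] by (auto simp: real_fun.independent_insert)
  qed
  have "smooth_L2_subspace A \<mu> (1 + 1) \<Lambda>"
    unfolding smooth_L2_subspace_def
  proof (intro conjI ballI impI)
    show "real_fun.subspace \<Lambda>" by (simp add: \<Lambda>_def)
    show "real_fun.dim \<Lambda> = 1 + 1"
      unfolding \<Lambda>_def real_fun.dim_span_eq_card_independent[OF indep]
      using not_const[of 1] by auto
    fix w assume "w \<in> \<Lambda>"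
    then obtain a b where w: "w = (\<lambda>x. a + b * u x)"
      by (auto simp: \<Lambda>_def mem_span_one_iff)
    show "smooth_fun A w"
      unfolding w by (rule smooth_fun_affine[OF u])
    then show "integrable \<mu> (\<lambda>x. (w x)\<^sup>2)"
      by (rule smooth_fun_integrable)
    assume "AE x in \<mu>. w x = 0"
    then have "(\<integral>\<^sup>+x. ennreal ((w x)\<^sup>2) \<partial>\<mu>) = (\<integral>\<^sup>+x. 0 \<partial>\<mu>)"
      by (intro nn_integral_cong_AE) auto
    then have "b\<^sup>2 * V + (a + b * expectation u)\<^sup>2 \<le> 0"
      unfolding w sq by (simp add: ennreal_eq_0_iff)
    then show "w = 0"
      using zero[of b a] by (simp add: w zero_fun_def)
  qed
  then have "eigenvalue A g \<mu> 1 \<le>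
      (SUP w\<in>\<Lambda> - {0}. dirichlet_energy A g w / (\<integral>\<^sup>+x. ennreal ((w x)\<^sup>2) \<partial>\<mu>))"
    unfolding eigenvalue_def by (intro INF_lower) auto
  also have "\<dots> \<le> dirichlet_energy A g u * ennreal (1 / V)"
  proof (rule SUP_least)
    fix w assume "w \<in> \<Lambda> - {0}"
    then obtain a b where w: "w = (\<lambda>x. a + b * u x)" "w \<noteq> 0"
      by (auto simp: \<Lambda>_def mem_span_one_iff)
    \<comment> \<open>\<open>W\<close> is the squared norm of \<open>w\<close>. Dropping the squared
      mean gives b^2 V \<le> W, so E(w)/W \<le> b^2 E(u)/W \<le> E(u)/V.\<close>
    define W where "W = b\<^sup>2 * V + (a + b * expectation u)\<^sup>2"
    have W: "W > 0"
      using zero[of b a] w by (force simp: W_def zero_fun_def)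
    moreover have "b\<^sup>2 * V \<le> W"
      by (simp add: W_def)
    ultimately have "b\<^sup>2 * (1 / W) \<le> 1 / V"
      using V by (auto simp: field_simps)
    have "dirichlet_energy A g w / (\<integral>\<^sup>+x. ennreal ((w x)\<^sup>2) \<partial>\<mu>) = dirichlet_energy A g w * ennreal (1 / W)"
      using W by (simp add: w(1) sq W_def[symmetric] divide_ennreal_def inverse_ennreal inverse_eq_divide)
    also have "\<dots> \<le> (ennreal (b\<^sup>2) * dirichlet_energy A g u) * ennreal (1 / W)"
      unfolding w(1) by (intro mult_right_mono dirichlet_energy_affine_le[OF atlas u]) simp
    also have "\<dots> = dirichlet_energy A g u * ennreal (b\<^sup>2 * (1 / W))"
      by (subst ennreal_mult'[OF zero_le_power2]) (simp only: mult_ac)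
    also have "\<dots> \<le> dirichlet_energy A g u * ennreal (1 / V)"
      using \<open>b\<^sup>2 * (1 / W) \<le> 1 / V\<close> by (intro mult_left_mono ennreal_leI) auto
    finally show "dirichlet_energy A g w / (\<integral>\<^sup>+x. ennreal ((w x)\<^sup>2) \<partial>\<mu>) \<le>
      dirichlet_energy A g u * ennreal (1 / V)" .
  qed
  finally have "eigenvalue A g \<mu> 1 * ennreal V \<le> dirichlet_energy A g u * ennreal (1 / V) * ennreal V"
    by (rule mult_right_mono) simp
  also have "\<dots> = dirichlet_energy A g u"
    using V by (simp add: mult.assoc flip: ennreal_mult')
  finally show ?thesis by (simp add: V_def)
qed simp

section \<open>From the eigenvalue to the capacity inequality\<close>

text \<open>With \<open>m\<close> the mean, the deviation of \<open>u\<close> is 1 - m on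
  \<open>F\<close> and -m off \<Omega>. Keeping only these two sets leaves p (1 - m)^2 + q m^2,
  which is then bounded below uniformly in m.\<close>

lemma variance_ge_product:
  assumes u: "smooth_fun A u" and F: "F \<in> sets \<mu>" "\<And>x. x \<in> F \<Longrightarrow> u x = 1"
    and \<Omega>: "\<Omega> \<in> sets \<mu>" "F \<subseteq> \<Omega>" "\<And>x. x \<notin> \<Omega> \<Longrightarrow> u x = 0"
  shows "prob F * (1 - prob \<Omega>) \<le> variance u"
proof -
  define m where "m = expectation u"
  define p where "p = prob F"
  define q where "q = 1 - prob \<Omega>"
  have pq: "p \<ge> 0" "q \<ge> 0" "p + q \<le> 1"
    using finite_measure_mono[OF \<Omega>(2,1)] by (auto simp: p_def q_def)
  have q: "q = prob (UNIV - \<Omega>)"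
    using prob_compl[OF \<Omega>(1)] by (simp add: q_def space_\<mu>)
  have "UNIV - \<Omega> \<in> sets \<mu>"
    using sets.compl_sets[OF \<Omega>(1)] by (simp add: space_\<mu>)
  then have "p * (1 - m)\<^sup>2 + q * m\<^sup>2 =
      expectation (\<lambda>x. (1 - m)\<^sup>2 * indicator F x + m\<^sup>2 * indicator (UNIV - \<Omega>) x)"
    using F(1) by (simp add: p_def q space_\<mu> emeasure_eq_measure mult.commute)
  also have "\<dots> \<le> variance u"
  proof (rule integral_mono)
    show "integrable \<mu> (\<lambda>x. (1 - m)\<^sup>2 * indicator F x + m\<^sup>2 * indicator (UNIV - \<Omega>) x)"
      using F(1) \<open>UNIV - \<Omega> \<in> sets \<mu>\<close>
      by (intro Bochner_Integration.integrable_add integrable_mult_right integrable_real_indicator)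
        (auto simp: emeasure_eq_measure)
    show "integrable \<mu> (\<lambda>x. (u x - expectation u)\<^sup>2)"
      using smooth_fun_integrable(2)[OF smooth_fun_affine[OF u, of "- expectation u" 1]] by simp
    show "(1 - m)\<^sup>2 * indicator F x + m\<^sup>2 * indicator (UNIV - \<Omega>) x \<le> (u x - expectation u)\<^sup>2" for x
      using F(2)[of x] \<Omega>(2) \<Omega>(3)[of x] by (auto simp: indicator_def m_def)
  qed
  finally have le: "p * (1 - m)\<^sup>2 + q * m\<^sup>2 \<le> variance u" .
  \<comment> \<open>Completing the square in m; the factor p + q is at most 1 because
    \<open>F\<close> and the complement of \<Omega> are disjoint.\<close>
  have "p * q \<le> ((p + q) * m - p)\<^sup>2 + p * q"
    by simp
  also have "\<dots> = (p + q) * (p * (1 - m)\<^sup>2 + q * m\<^sup>2)"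
    by (simp add: power2_eq_square algebra_simps)
  also have "\<dots> \<le> 1 * (p * (1 - m)\<^sup>2 + q * m\<^sup>2)"
    using pq by (intro mult_right_mono) auto
  finally show ?thesis
    using le by (simp add: p_def q_def)
qed

lemma eigenvalue_le_capacity:
  assumes "closed F" "open \<Omega>" "F \<subseteq> \<Omega>"
  shows "eigenvalue A g \<mu> 1 * ennreal (prob F * (1 - prob \<Omega>)) \<le> capacity A g F \<Omega>"
  unfolding capacity_def
proof (rule INF_greatest)
  fix f assume f: "f \<in> {f. smooth_fun A f \<and> compact (closure {x. f x \<noteq> 0}) \<and>
                closure {x. f x \<noteq> 0} \<subseteq> \<Omega> \<and> (\<forall>x\<in>F. f x = 1)}"
  then have "closure {x. f x \<noteq> 0} \<subseteq> \<Omega>"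
    by simp
  then have "{x. f x \<noteq> 0} \<subseteq> \<Omega>"
    by (rule order_trans[OF closure_subset])
  then have out: "f x = 0" if "x \<notin> \<Omega>" for x
    using that by auto
  have "prob F * (1 - prob \<Omega>) \<le> variance f"
  proof (rule variance_ge_product)
    show "smooth_fun A f" "\<And>x. x \<in> F \<Longrightarrow> f x = 1"
      using f by auto
    show "F \<in> sets \<mu>" "\<Omega> \<in> sets \<mu>"
      using assms by (auto simp: sets_\<mu>)
  qed (fact assms(3), fact out)
  then have "eigenvalue A g \<mu> 1 * ennreal (prob F * (1 - prob \<Omega>)) \<le> eigenvalue A g \<mu> 1 * ennreal (variance f)"
    by (intro mult_left_mono ennreal_leI) auto
  also have "\<dots> \<le> dirichlet_energy A g f"
    using f by (intro eigenvalue_mult_variance_le) auto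
  finally show "eigenvalue A g \<mu> 1 * ennreal (prob F * (1 - prob \<Omega>)) \<le> dirichlet_energy A g f" .
qed

lemma capacity_inequality_if_eigenvalue_nonzero:
  assumes "eigenvalue A g \<mu> 1 \<noteq> 0"
  shows "\<exists>C>0. \<forall>F \<Omega>. closed F \<longrightarrow> open \<Omega> \<longrightarrow> F \<subseteq> \<Omega> \<longrightarrow> prob \<Omega> \<le> 1 / 2 \<longrightarrow>
      emeasure \<mu> F \<le> ennreal C * capacity A g F \<Omega>"
proof -
  \<comment> \<open>The eigenvalue can be infinite, for instance for a Dirac measure, where no
    two-dimensional test space exists. Capping it at 1 yields a positive real number.\<close>
  define l where "l = enn2real (min 1 (eigenvalue A g \<mu> 1))"
  have "ennreal l = min 1 (eigenvalue A g \<mu> 1)"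
    unfolding l_def by (rule ennreal_enn2real) (simp add: min_less_iff_disj)
  then have l: "l > 0" "ennreal l \<le> eigenvalue A g \<mu> 1"
    using assms by (auto simp: l_def enn2real_positive_iff min_less_iff_disj gr_zeroI)
  show ?thesis
  proof (intro exI[of _ "2 / l"] conjI allI impI)
    fix F \<Omega> assume *: "closed F" "open \<Omega>" "F \<subseteq> \<Omega>" "prob \<Omega> \<le> 1 / 2"
    define z where "z = prob F * (1 - prob \<Omega>)"
    \<comment> \<open>The bound 1/2 on the measure of \<Omega> keeps its complement from being small
      and accounts for the 2 in the constant 2 / l.\<close>
    have "prob F * (1 / 2) \<le> z"
      unfolding z_def using *(4) by (intro mult_left_mono) auto
    then have "prob F \<le> (2 / l) * (l * z)"
      using l by simp
    then have "emeasure \<mu> F \<le> ennreal ((2 / l) * (l * z))"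
      unfolding emeasure_eq_measure by (rule ennreal_leI)
    also have "\<dots> = ennreal (2 / l) * (ennreal l * ennreal z)"
      using l by (simp only: ennreal_mult' less_imp_le divide_nonneg_pos zero_le_numeral)
    also have "\<dots> \<le> ennreal (2 / l) * (eigenvalue A g \<mu> 1 * ennreal z)"
      using l by (intro mult_left_mono mult_right_mono) auto
    also have "\<dots> \<le> ennreal (2 / l) * capacity A g F \<Omega>"
      using eigenvalue_le_capacity[OF *(1-3)] by (intro mult_left_mono) (auto simp: z_def)
    finally show "emeasure \<mu> F \<le> ennreal (2 / l) * capacity A g F \<Omega>" .
  qed (use l in simp)
qed


section \<open>From the capacity inequality to the eigenvalue\<close>

text \<open>Maz'ya's truncation argument: apply the capacity inequality to the dyadic superlevel sets of \<open>w\<close>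
  and test each capacity with a cutoff of \<open>w\<close>, whose energy lives on one dyadic layer only.\<close>

lemma positive_part_energy_bound:
  assumes C: "C > 0"
    and cap: "\<And>F \<Omega>. closed F \<Longrightarrow> open \<Omega> \<Longrightarrow> F \<subseteq> \<Omega> \<Longrightarrow> 0 < prob \<Omega> \<Longrightarrow> prob \<Omega> \<le> 1 / 2 \<Longrightarrow>
      emeasure \<mu> F \<le> ennreal C * capacity A g F \<Omega>"
  shows "\<exists>K>0. \<forall>w. smooth_fun A w \<longrightarrow> (\<forall>\<epsilon>>0. prob {x. w x > \<epsilon>} \<le> 1 / 2) \<longrightarrow>
      (\<integral>\<^sup>+x. ennreal ((max 0 (w x))\<^sup>2) \<partial>\<mu>) \<le> ennreal K * dirichlet_energy A g w"
proof -
  obtain \<eta> \<eta>' B where \<eta>: "Cinf_real \<eta>" "\<And>t. (\<eta> has_field_derivative \<eta>' t) (at t)"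
    "\<And>t. t \<le> 0 \<Longrightarrow> \<eta> t = 0" "\<And>t. 1 \<le> t \<Longrightarrow> \<eta> t = 1"
    "\<And>t. t \<notin> {0<..<1} \<Longrightarrow> \<eta>' t = 0" "B > 0" "\<And>t. \<bar>\<eta>' t\<bar> \<le> B"
    by (rule smooth_cutoff) (rule that)
  \<comment> \<open>\<open>B\<close> bounds the slope of the cutoff profile, and 16 is the square of
    the ratio 4 between the levels \<open>a k\<close> and \<open>a (k + 2)\<close>.\<close>
  define K where "K = C * (16 * B\<^sup>2)"
  have "K > 0" using C \<eta>(6) by (simp add: K_def)
  have "(\<integral>\<^sup>+x. ennreal ((max 0 (w x))\<^sup>2) \<partial>\<mu>) \<le> ennreal K * dirichlet_energy A g w"
    if w: "smooth_fun A w" and half: "\<And>\<epsilon>. \<epsilon> > 0 \<Longrightarrow> prob {x. w x > \<epsilon>} \<le> 1 / 2" for w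
  proof -
    obtain R where R: "R > 0" "\<And>x. \<bar>w x\<bar> \<le> R"
      by (rule smooth_fun_bounded[OF w]) (rule that)
    note cont = smooth_fun_continuous[OF w]
    define a where "a k = R / 2 ^ k" for k :: nat
    have a_pos: "a k > 0" for k using R by (simp add: a_def)
    have a_Suc: "a k = 2 * a (Suc k)" for k by (simp add: a_def)
    have a_mono: "a k \<le> a l" if "l \<le> k" for k l
      using R that by (auto simp: a_def intro!: divide_left_mono)
    have closed_ge: "closed {x. t \<le> w x}" for t
      by (intro closed_Collect_le cont continuous_on_const)
    have open_gt: "open {x. t < w x}" for t
      by (intro open_Collect_less cont continuous_on_const)
    have [measurable]: "{x. t \<le> w x} \<in> sets \<mu>" for t
      using closed_ge by (simp add: sets_\<mu>)
    \<comment> \<open>The layer on which the cutoff for the level \<open>a (k + 1)\<close>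
      varies.\<close>
    define D where "D k = {x. a (k + 2) < w x \<and> w x < a (k + 1)}" for k
    define Q where "Q x = ennreal (grad_norm_sq A g w x) * indicator (surface_interior A) x" for x
    have energy: "dirichlet_energy A g w = (\<integral>\<^sup>+x. Q x \<partial>riemannian_volume A g)"
      by (simp add: dirichlet_energy_def Q_def)
    \<comment> \<open>Summed over k, these step functions dominate the squared positive part of
      \<open>w\<close>, and their integrals are weighted measures of superlevel sets.\<close>
    define h where "h x k = ennreal ((a k)\<^sup>2) * indicator {x. a (Suc k) \<le> w x} x" for x k
    have pointwise: "ennreal ((max 0 (w x))\<^sup>2) \<le> (\<Sum>k. h x k)" for x
    proof (cases "w x > 0")
      case True
      obtain n where "R / w x < 2 ^ n"
        using real_arch_pow[of 2 "R / w x"] by auto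
      then have "a n \<le> w x"
        using True by (simp add: a_def field_simps)
      then have ex: "\<exists>n. a (Suc n) \<le> w x"
        using a_mono[of n "Suc n"] by (meson order_trans le_SucI order_refl)
      \<comment> \<open>Minimality of k gives w(x) \<le> a(k), with the global bound R = a(0)
        covering k = 0. Thus the single term \<open>h x k\<close> already dominates.\<close>
      define k where "k = (LEAST n. a (Suc n) \<le> w x)"
      have k: "a (Suc k) \<le> w x"
        unfolding k_def by (rule LeastI_ex[OF ex])
      have "w x \<le> a k"
      proof (cases k)
        case 0
        then show ?thesis using R(2)[of x] by (simp add: a_def)
      next
        case (Suc j)
        then show ?thesis
          using not_less_Least[of j "\<lambda>n. a (Suc n) \<le> w x"] by (simp add: k_def)
      qed
      then have "ennreal ((max 0 (w x))\<^sup>2) \<le> h x k"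
        using True k by (auto simp: h_def intro!: ennreal_leI power_mono)
      also have "\<dots> \<le> (\<Sum>k. h x k)"
        using sum_le_suminf[of "h x" "{k}"] by simp
      finally show ?thesis .
    qed simp
    have layer: "ennreal ((a k)\<^sup>2) * emeasure \<mu> {x. a (Suc k) \<le> w x} \<le>
        ennreal K * (\<integral>\<^sup>+x. indicator (D k) x * Q x \<partial>riemannian_volume A g)" for k
    proof (cases "prob {x. a (k + 3) < w x} = 0")
      \<comment> \<open>The capacity inequality is assumed only for \<Omega> of positive measure;
        here the left-hand side vanishes.\<close>
      case True
      have "emeasure \<mu> {x. a (Suc k) \<le> w x} \<le> emeasure \<mu> {x. a (k + 3) < w x}"
      proof (rule emeasure_mono)
        have "a (k + 3) < a (Suc k)"
          using a_pos[of "k + 3"] a_Suc[of "Suc k"] a_Suc[of "k + 2"] by (simp add: numeral_eq_Suc)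
        then show "{x. a (Suc k) \<le> w x} \<subseteq> {x. a (k + 3) < w x}" by auto
      qed (simp add: sets_\<mu> open_gt)
      then show ?thesis
        using True by (simp add: emeasure_eq_measure)
    next
      case False
      define b where "b = a (k + 2)"
      have b: "b > 0" "a (Suc k) = 2 * b" "a k = 4 * b" "a (k + 3) < b"
        using R(1) by (simp_all add: a_def b_def power_add field_simps)
      \<comment> \<open>The cutoff is 0 for w \<le> b and 1 for w \<ge> 2b = a(k + 1). Its closed
        support lies in {w \<ge> b}; the extra level \<open>a (k + 3)\<close> below b provides an
        open \<Omega> containing it.\<close>
      define f where "f x = \<eta> (-1 + (1 / b) * w x)" for x
      have smooth: "smooth_fun A f"
        unfolding f_def using smooth_fun_compose[OF smooth_fun_affine[OF w] \<eta>(1)] .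
      have deriv: "((\<lambda>t. \<eta> (-1 + (1 / b) * t)) has_field_derivative \<eta>' (-1 + (1 / b) * t) * (1 / b)) (at t)" for t
        by (rule DERIV_chain2[OF \<eta>(2)]) (use b(1) in \<open>auto intro!: derivative_eq_intros\<close>)
      have "closure {x. f x \<noteq> 0} \<subseteq> {x. b \<le> w x}"
      proof (rule closure_minimal[OF _ closed_ge])
        show "{x. f x \<noteq> 0} \<subseteq> {x. b \<le> w x}"
        proof (rule subsetI, rule ccontr)
          fix x assume "x \<in> {x. f x \<noteq> 0}" "x \<notin> {x. b \<le> w x}"
          with b \<eta>(3)[of "-1 + (1 / b) * w x"] show False
            by (simp add: f_def)
        qed
      qed
      moreover have "compact (closure {x. f x \<noteq> 0})"
        using compact_Int_closed[OF compact_UNIV closed_closure] by simp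
      moreover have "f x = 1" if "a (Suc k) \<le> w x" for x
        using that b by (simp add: f_def \<eta>(4) field_simps)
      ultimately have cap_le: "capacity A g {x. a (Suc k) \<le> w x} {x. a (k + 3) < w x} \<le> dirichlet_energy A g f"
        unfolding capacity_def using smooth b by (intro INF_lower) auto
      have coeff: "ennreal ((\<eta>' (-1 + (1 / b) * w x) * (1 / b))\<^sup>2) \<le> ennreal (B\<^sup>2 / b\<^sup>2) * indicator (D k) x" for x
      proof (cases "x \<in> D k")
        case True
        have "(\<eta>' (-1 + (1 / b) * w x))\<^sup>2 \<le> B\<^sup>2"
          using \<eta>(7) power_mono[OF \<eta>(7) abs_ge_zero, of _ 2] by simp
        then show ?thesis
          using True b by (auto simp: power_mult_distrib power_divide intro!: ennreal_leI divide_right_mono)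
      next
        case False
        then have "-1 + (1 / b) * w x \<notin> {0<..<1}"
          using b by (auto simp: D_def b_def field_simps)
        then show ?thesis using \<eta>(5) by simp
      qed
      have "dirichlet_energy A g f =
          (\<integral>\<^sup>+x. ennreal ((\<eta>' (-1 + (1 / b) * w x) * (1 / b))\<^sup>2) * Q x \<partial>riemannian_volume A g)"
        unfolding f_def dirichlet_energy_compose[OF atlas w deriv] Q_def by (simp only: mult.assoc)
      also have "\<dots> \<le> (\<integral>\<^sup>+x. ennreal (B\<^sup>2 / b\<^sup>2) * (indicator (D k) x * Q x) \<partial>riemannian_volume A g)"
        unfolding mult.assoc[symmetric] by (intro nn_integral_mono mult_right_mono coeff) simp
      also have "\<dots> \<le> ennreal (B\<^sup>2 / b\<^sup>2) * (\<integral>\<^sup>+x. indicator (D k) x * Q x \<partial>riemannian_volume A g)"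
        using \<eta>(6) b by (intro nn_integral_cmult_le) simp
      finally have energy_f: "dirichlet_energy A g f \<le>
        ennreal (B\<^sup>2 / b\<^sup>2) * (\<integral>\<^sup>+x. indicator (D k) x * Q x \<partial>riemannian_volume A g)" .
      have "emeasure \<mu> {x. a (Suc k) \<le> w x} \<le> ennreal C * capacity A g {x. a (Suc k) \<le> w x} {x. a (k + 3) < w x}"
        using False b half[OF a_pos] by (intro cap closed_ge open_gt) (auto simp: less_le)
      also have "\<dots> \<le> ennreal C * (ennreal (B\<^sup>2 / b\<^sup>2) * (\<integral>\<^sup>+x. indicator (D k) x * Q x \<partial>riemannian_volume A g))"
        using cap_le energy_f by (intro mult_left_mono) auto
      finally have "ennreal ((a k)\<^sup>2) * emeasure \<mu> {x. a (Suc k) \<le> w x} \<le>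
        ennreal ((a k)\<^sup>2) * (ennreal C * (ennreal (B\<^sup>2 / b\<^sup>2) * (\<integral>\<^sup>+x. indicator (D k) x * Q x \<partial>riemannian_volume A g)))"
        by (rule mult_left_mono) simp
      also have "\<dots> = ennreal ((a k)\<^sup>2 * (C * (B\<^sup>2 / b\<^sup>2))) * (\<integral>\<^sup>+x. indicator (D k) x * Q x \<partial>riemannian_volume A g)"
        using C by (simp only: ennreal_mult' zero_le_power2 less_imp_le mult.assoc)
      \<comment> \<open>Since a(k) = 4b, the weight cancels the factor 1/b^2 from the gradient of
        the cutoff, leaving a constant independent of k.\<close>
      also have "(a k)\<^sup>2 * (C * (B\<^sup>2 / b\<^sup>2)) = K"
        using b by (simp add: K_def power2_eq_square field_simps)
      finally show ?thesis .
    qed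
    \<comment> \<open>The layers are preimages of consecutive open intervals of levels, so each part
      of the energy is counted at most once.\<close>
    have disjoint: "disjoint_family D"
      unfolding disjoint_family_on_def
    proof (intro ballI impI)
      fix k l :: nat assume "k \<noteq> l"
      then consider "Suc k \<le> l" | "Suc l \<le> k" by linarith
      then show "D k \<inter> D l = {}"
        by cases (use a_mono[of "k + 2" "l + 1"] a_mono[of "l + 2" "k + 1"] in \<open>fastforce simp: D_def\<close>)+
    qed
    have "(\<integral>\<^sup>+x. ennreal ((max 0 (w x))\<^sup>2) \<partial>\<mu>) \<le>
        (\<integral>\<^sup>+x. (\<Sum>k. h x k) \<partial>\<mu>)"
      by (intro nn_integral_mono pointwise)
    also have "\<dots> = (\<Sum>k. ennreal ((a k)\<^sup>2) * emeasure \<mu> {x. a (Suc k) \<le> w x})"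
      unfolding h_def by (subst nn_integral_suminf) (simp_all add: nn_integral_cmult_indicator)
    also have "\<dots> \<le> (\<Sum>k. ennreal K * (\<integral>\<^sup>+x. indicator (D k) x * Q x \<partial>riemannian_volume A g))"
      by (intro suminf_le layer) auto
    also have "\<dots> = ennreal K * (\<Sum>k. \<integral>\<^sup>+x. indicator (D k) x * Q x \<partial>riemannian_volume A g)"
      by simp
    also have "\<dots> \<le> ennreal K * (\<integral>\<^sup>+x. (\<Sum>k. indicator (D k) x * Q x) \<partial>riemannian_volume A g)"
      by (intro mult_left_mono nn_integral_suminf_superadditive) simp
    also have "\<dots> \<le> ennreal K * dirichlet_energy A g w"
      unfolding energy
    proof (intro mult_left_mono nn_integral_mono)
      fix x
      have "(\<Sum>k. indicator (D k) x * Q x) = (indicator (\<Union>k. D k) x :: ennreal) * Q x"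
        by (simp add: ennreal_suminf_multc suminf_indicator[OF disjoint])
      also have "\<dots> \<le> Q x"
        by (simp add: indicator_def)
      finally show "(\<Sum>k. indicator (D k) x * Q x) \<le> Q x" .
    qed simp
    finally show ?thesis .
  qed
  with \<open>K > 0\<close> show ?thesis
    by blast
qed

text \<open>The median is the infimum of the levels t with \<mu>(u > t) \<le> 1/2. The margin
  \<epsilon> lets both bounds follow from the definition of an infimum.\<close>

lemma median_exists:
  assumes "smooth_fun A u"
  obtains m where "\<And>\<epsilon>. \<epsilon> > 0 \<Longrightarrow> prob {x. u x - m > \<epsilon>} \<le> 1 / 2"
    "\<And>\<epsilon>. \<epsilon> > 0 \<Longrightarrow> prob {x. m - u x > \<epsilon>} \<le> 1 / 2"
proof -
  obtain R where R: "R > 0" "\<And>x. \<bar>u x\<bar> \<le> R"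
    by (rule smooth_fun_bounded[OF assms]) (rule that)
  have sets_gt: "{x. t < u x} \<in> sets \<mu>" for t
    unfolding sets_\<mu>
    by (intro borel_open open_Collect_less smooth_fun_continuous[OF assms] continuous_on_const)
  define S where "S = {t. prob {x. t < u x} \<le> 1 / 2}"
  have "{x. R < u x} = {}"
    using R(2) by (force simp: abs_le_iff not_less)
  then have "R \<in> S" by (simp add: S_def)
  have "- R \<le> t" if "t \<in> S" for t
  proof (rule ccontr)
    assume "\<not> - R \<le> t"
    then have "t < u x" for x
      using R(2)[of x] by linarith
    then have "{x. t < u x} = UNIV" by auto
    with that prob_space show False by (simp add: S_def space_\<mu>)
  qed
  then have bdd: "bdd_below S" by (rule bdd_belowI)
  define m where "m = Inf S"
  show thesis
  proof (rule that[of m])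
    fix \<epsilon> :: real assume "\<epsilon> > 0"
    then have "Inf S < m + \<epsilon>" by (simp add: m_def)
    then obtain t where t: "t \<in> S" "t < m + \<epsilon>"
      using cInf_lessD \<open>R \<in> S\<close> by (metis empty_iff)
    then have "prob {x. u x - m > \<epsilon>} \<le> prob {x. t < u x}"
      by (intro finite_measure_mono sets_gt) auto
    with t(1) show "prob {x. u x - m > \<epsilon>} \<le> 1 / 2"
      by (simp add: S_def)
    \<comment> \<open>Below the infimum the superlevel set has measure more than 1/2, so its
      complement has less.\<close>
    have "m - \<epsilon> \<notin> S"
      using cInf_lower[OF _ bdd, of "m - \<epsilon>"] \<open>\<epsilon> > 0\<close> by (auto simp: m_def)
    then have "prob (space \<mu> - {x. m - \<epsilon> < u x}) \<le> 1 / 2"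
      by (subst prob_compl[OF sets_gt]) (simp add: S_def)
    moreover have "prob {x. m - u x > \<epsilon>} \<le> prob (space \<mu> - {x. m - \<epsilon> < u x})"
      by (intro finite_measure_mono sets.compl_sets sets_gt) (auto simp: space_\<mu>)
    ultimately show "prob {x. m - u x > \<epsilon>} \<le> 1 / 2" by simp
  qed
qed

text \<open>The mean is a linear functional, so it has a nontrivial kernel on a two-dimensional
  space.\<close>

lemma mean_zero_element:
  assumes \<Lambda>: "smooth_L2_subspace A \<mu> 2 \<Lambda>"
  obtains u where "u \<in> \<Lambda>" "u \<noteq> 0" "expectation u = 0"
proof -
  have sub: "real_fun.subspace \<Lambda>" and dim: "real_fun.dim \<Lambda> = 2"
    and smooth: "\<And>u. u \<in> \<Lambda> \<Longrightarrow> smooth_fun A u"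
    using \<Lambda> by (auto simp: smooth_L2_subspace_def)
  obtain X where X: "X \<subseteq> \<Lambda>" "\<not> real_fun.dependent X" "card X = 2"
    using real_fun.basis_exists[of \<Lambda>] dim by metis
  then obtain v w where vw: "X = {v, w}" "v \<noteq> w"
    by (meson card_2_iff)
  show thesis
  proof (cases "expectation w = 0")
    case True
    have "w \<noteq> 0"
      using X(2) vw real_fun.dependent_zero by auto
    with True X(1) vw(1) show ?thesis by (intro that[of w]) auto
  next
    case False
    \<comment> \<open>The combination of the basis vectors whose means cancel; independence and the
      nonzero mean of \<open>w\<close> make it nonzero.\<close>
    define u where "u = (\<lambda>x. expectation w * v x) - (\<lambda>x. expectation v * w x)"
    show ?thesis
    proof (rule that[of u])
      show "u \<in> \<Lambda>"
        unfolding u_def using X(1) vw(1)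
        by (intro real_fun.subspace_diff[OF sub] real_fun.subspace_scale[OF sub]) auto
      show "expectation u = 0"
        using smooth_fun_integrable(1)[OF smooth] X(1) vw(1) by (simp add: u_def fun_diff_def)
      show "u \<noteq> 0"
      proof
        assume "u = 0"
        then have "v = (\<lambda>x. (expectation v / expectation w) * w x)"
          using False by (simp add: u_def fun_eq_iff field_simps)
        then have "v \<in> real_fun.span {w}"
          unfolding real_fun.span_singleton by blast
        with X(2) vw show False
          by (simp add: real_fun.independent_insert)
      qed
    qed
  qed
qed

lemma eigenvalue_nonzero_if_capacity_inequality:
  assumes C: "C > 0"
    and cap: "\<And>F \<Omega>. closed F \<Longrightarrow> open \<Omega> \<Longrightarrow> F \<subseteq> \<Omega> \<Longrightarrow> 0 < prob \<Omega> \<Longrightarrow> prob \<Omega> \<le> 1 / 2 \<Longrightarrow>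
      emeasure \<mu> F \<le> ennreal C * capacity A g F \<Omega>"
  shows "eigenvalue A g \<mu> 1 \<noteq> 0"
proof -
  obtain K where K: "K > 0"
    "\<And>w. smooth_fun A w \<Longrightarrow> \<forall>\<epsilon>>0. prob {x. w x > \<epsilon>} \<le> 1 / 2 \<Longrightarrow>
      (\<integral>\<^sup>+x. ennreal ((max 0 (w x))\<^sup>2) \<partial>\<mu>) \<le> ennreal K * dirichlet_energy A g w"
    using positive_part_energy_bound[OF C cap] by blast
  have "ennreal (1 / (2 * K)) \<le> eigenvalue A g \<mu> 1"
    unfolding eigenvalue_def
  proof (rule INF_greatest)
    fix \<Lambda> assume "\<Lambda> \<in> {\<Lambda>. smooth_L2_subspace A \<mu> (1 + 1) \<Lambda>}"
    then have \<Lambda>: "smooth_L2_subspace A \<mu> 2 \<Lambda>" by (simp add: numeral_2_eq_2)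
    obtain u where u: "u \<in> \<Lambda>" "u \<noteq> 0" "expectation u = 0"
      by (rule mean_zero_element[OF \<Lambda>]) (rule that)
    have smooth: "smooth_fun A u" and nonnull: "\<not> (AE x in \<mu>. u x = 0)"
      using \<Lambda> u by (auto simp: smooth_L2_subspace_def)
    note [measurable] = smooth_fun_measurable[OF smooth]
    obtain m where m: "\<And>\<epsilon>. \<epsilon> > 0 \<Longrightarrow> prob {x. u x - m > \<epsilon>} \<le> 1 / 2"
      "\<And>\<epsilon>. \<epsilon> > 0 \<Longrightarrow> prob {x. m - u x > \<epsilon>} \<le> 1 / 2"
      by (rule median_exists[OF smooth]) (rule that)
    define S where "S = expectation (\<lambda>x. (u x)\<^sup>2)"
    have S: "(\<integral>\<^sup>+x. ennreal ((u x)\<^sup>2) \<partial>\<mu>) = ennreal S"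
      using nn_integral_sq[OF smooth] by (simp add: S_def)
    \<comment> \<open>A nonzero element of a test space is nonzero in L2.\<close>
    have "S > 0"
    proof (rule ccontr)
      assume "\<not> S > 0"
      then have "(\<integral>\<^sup>+x. ennreal ((u x)\<^sup>2) \<partial>\<mu>) = 0"
        by (simp add: S ennreal_eq_0_iff)
      then have "AE x in \<mu>. ennreal ((u x)\<^sup>2) = 0"
        by (subst (asm) nn_integral_0_iff_AE) auto
      then have "AE x in \<mu>. u x = 0"
        by eventually_elim (simp add: ennreal_eq_0_iff)
      with nonnull show False by blast
    qed
    \<comment> \<open>Taken with b = 1 and b = -1, this covers the positive and the negative part of
      u - m.\<close>
    have affine: "(\<integral>\<^sup>+x. ennreal ((max 0 (a + b * u x))\<^sup>2) \<partial>\<mu>) \<le> ennreal K * dirichlet_energy A g u"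
      if "b\<^sup>2 = 1" "\<And>\<epsilon>. \<epsilon> > 0 \<Longrightarrow> prob {x. a + b * u x > \<epsilon>} \<le> 1 / 2" for a b
    proof -
      have "(\<integral>\<^sup>+x. ennreal ((max 0 (a + b * u x))\<^sup>2) \<partial>\<mu>) \<le>
          ennreal K * dirichlet_energy A g (\<lambda>x. a + b * u x)"
        using that(2) by (intro K(2)[OF smooth_fun_affine[OF smooth]]) blast
      also have "\<dots> \<le> ennreal K * (ennreal (b\<^sup>2) * dirichlet_energy A g u)"
        by (intro mult_left_mono dirichlet_energy_affine_le[OF atlas smooth]) simp
      finally show ?thesis
        by (simp add: that(1))
    qed
    \<comment> \<open>For mean-zero \<open>u\<close> the second moment is the variance, which is the
      least mean square deviation from a constant; the median is one such constant.\<close>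
    have "S \<le> 1\<^sup>2 * variance u + (- m + 1 * expectation u)\<^sup>2"
      using variance_eq[OF smooth_fun_integrable[OF smooth]] u(3) by (simp add: S_def)
    then have "ennreal S \<le> ennreal (expectation (\<lambda>x. (- m + 1 * u x)\<^sup>2))"
      unfolding expectation_affine_sq[OF smooth] by (rule ennreal_leI)
    also have "\<dots> = (\<integral>\<^sup>+x. ennreal ((- m + 1 * u x)\<^sup>2) \<partial>\<mu>)"
      by (rule nn_integral_sq[OF smooth_fun_affine[OF smooth], symmetric])
    also have "\<dots> = (\<integral>\<^sup>+x. ennreal ((max 0 (- m + 1 * u x))\<^sup>2) + ennreal ((max 0 (m + (- 1) * u x))\<^sup>2) \<partial>\<mu>)"
      by (intro nn_integral_cong) (auto simp: max_def power2_eq_square algebra_simps)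
    also have "\<dots> = (\<integral>\<^sup>+x. ennreal ((max 0 (- m + 1 * u x))\<^sup>2) \<partial>\<mu>) + (\<integral>\<^sup>+x. ennreal ((max 0 (m + (- 1) * u x))\<^sup>2) \<partial>\<mu>)"
      by (intro nn_integral_add) auto
    also have "\<dots> \<le> ennreal K * dirichlet_energy A g u + ennreal K * dirichlet_energy A g u"
      using m by (intro add_mono affine) auto
    also have "\<dots> = ennreal (2 * K) * dirichlet_energy A g u"
      using K(1) by (simp add: ennreal_mult' mult.assoc flip: mult_2)
    finally have *: "ennreal S \<le> ennreal (2 * K) * dirichlet_energy A g u" .
    have "ennreal (1 / (2 * K)) = ennreal (1 / (2 * K)) * (ennreal S * ennreal (1 / S))"
      using \<open>S > 0\<close> by (simp flip: ennreal_mult')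
    also have "\<dots> \<le> ennreal (1 / (2 * K)) * (ennreal (2 * K) * dirichlet_energy A g u * ennreal (1 / S))"
      by (intro mult_left_mono mult_right_mono *) auto
    also have "\<dots> = ennreal (1 / (2 * K) * (2 * K)) * dirichlet_energy A g u * ennreal (1 / S)"
      using K(1) by (subst ennreal_mult') (simp_all only: mult.assoc, simp)
    also have "\<dots> = dirichlet_energy A g u / (\<integral>\<^sup>+x. ennreal ((u x)\<^sup>2) \<partial>\<mu>)"
      using K(1) \<open>S > 0\<close> by (simp add: S divide_ennreal_def inverse_ennreal inverse_eq_divide)
    also have "\<dots> \<le> (SUP u\<in>\<Lambda> - {0}. dirichlet_energy A g u / (\<integral>\<^sup>+x. ennreal ((u x)\<^sup>2) \<partial>\<mu>))"
      using u by (intro SUP_upper) auto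
    finally show "ennreal (1 / (2 * K)) \<le>
      (SUP u\<in>\<Lambda> - {0}. dirichlet_energy A g u / (\<integral>\<^sup>+x. ennreal ((u x)\<^sup>2) \<partial>\<mu>))" .
  qed
  moreover have "ennreal (1 / (2 * K)) > 0"
    using K(1) by simp
  ultimately show ?thesis by auto
qed

section \<open>Sets of zero capacity\<close>

lemma emeasure_eq_0_if_compact_null:
  assumes "radon_measure \<mu>" "B \<in> sets borel"
    and "\<And>K. compact K \<Longrightarrow> K \<subseteq> B \<Longrightarrow> prob K = 0"
  shows "emeasure \<mu> B = 0"
proof -
  have "emeasure \<mu> B = (SUP K\<in>{K. compact K \<and> K \<in> sets borel \<and> K \<subseteq> B}. emeasure \<mu> K)"
    using assms(1,2) by (simp add: radon_measure_def)
  also have "\<dots> \<le> 0"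
    using assms(3) by (intro SUP_least) (auto simp: emeasure_eq_measure)
  finally show ?thesis by simp
qed

text \<open>The point is any element of the intersection of all compact subsets of \<open>F\<close> of full measure.\<close>

lemma dirac_if_two_valued:
  assumes radon: "radon_measure \<mu>" and F: "compact F" "prob F \<noteq> 0"
    and two: "\<And>K. compact K \<Longrightarrow> K \<subseteq> F \<Longrightarrow> prob K = 0 \<or> prob K = 1"
  obtains p where "\<mu> = return borel p"
proof -
  define \<K> where "\<K> = {K. compact K \<and> K \<subseteq> F \<and> prob K = 1}"
  have meas: "K \<in> sets \<mu>" if "compact K" for K
    using compact_imp_closed[OF that] by (simp add: sets_\<mu>)
  \<comment> \<open>Intersecting with \<open>F\<close> keeps the empty family inside
    \<open>F\<close>.\<close>
  have inter_meas: "F \<inter> \<Inter>\<F> \<in> sets \<mu>" if "\<F> \<subseteq> \<K>" for \<F>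
  proof -
    have "closed (F \<inter> \<Inter>\<F>)"
      using that by (intro closed_Int closed_Inter ballI compact_imp_closed F(1)) (auto simp: \<K>_def)
    then show ?thesis by (simp add: sets_\<mu>)
  qed
  have inter: "finite \<F> \<Longrightarrow> \<F> \<subseteq> \<K> \<Longrightarrow> prob (F \<inter> \<Inter>\<F>) = 1" for \<F>
  proof (induction \<F> rule: finite_induct)
    case empty
    then show ?case using F two[of F] by auto
  next
    case (insert K \<F>)
    have "F \<inter> \<Inter>\<F> \<in> sets \<mu>"
      using insert.prems by (intro inter_meas) simp
    moreover have "K \<in> sets \<mu>" "prob K = 1"
      using insert.prems meas by (auto simp: \<K>_def)
    ultimately have "AE x in \<mu>. x \<in> F \<inter> \<Inter>\<F>" "AE x in \<mu>. x \<in> K"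
      by (subst AE_in_set_eq_1; use insert in simp)+
    then have "AE x in \<mu>. x \<in> F \<inter> \<Inter>(insert K \<F>)"
      by eventually_elim auto
    then show ?case
      by (subst (asm) AE_in_set_eq_1[OF inter_meas[OF insert.prems]])
  qed
  \<comment> \<open>Finite intersections have full measure and so are nonempty; compactness of
    \<open>F\<close> passes this to the whole family.\<close>
  have "F \<inter> \<Inter>\<K> \<noteq> {}"
  proof (rule compact_imp_fip[OF F(1)])
    show "closed K" if "K \<in> \<K>" for K
      using that by (auto simp: \<K>_def intro: compact_imp_closed)
    show "F \<inter> \<Inter>\<F> \<noteq> {}" if "finite \<F>" "\<F> \<subseteq> \<K>" for \<F>
      using inter[OF that] by auto
  qed
  then obtain p where p: "p \<in> F" "\<And>K. K \<in> \<K> \<Longrightarrow> p \<in> K" by auto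
  \<comment> \<open>A compact subset of \<open>F\<close> of measure 1 contains p, so every compact
    subset avoiding p has measure 0; inner regularity does the rest.\<close>
  have "emeasure \<mu> (F - {p}) = 0"
  proof (rule emeasure_eq_0_if_compact_null[OF radon])
    show "F - {p} \<in> sets borel"
      using meas[OF F(1)] by (simp add: sets_\<mu>)
    show "prob K = 0" if "compact K" "K \<subseteq> F - {p}" for K
      using two[of K] that p(2)[of K] by (auto simp: \<K>_def)
  qed
  moreover have "AE x in \<mu>. x \<in> F"
    using inter[of "{}"] meas[OF F(1)] by (simp add: AE_in_set_eq_1)
  ultimately have AE: "AE x in \<mu>. x = p"
    using AE_iff_null_sets[of "F - {p}" \<mu>] meas[OF F(1)]
    by (auto simp: null_sets_def sets_\<mu> elim: eventually_elim2)
  have "\<mu> = return borel p"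
  proof (rule measure_eqI)
    fix B assume B: "B \<in> sets \<mu>"
    have "emeasure \<mu> B = emeasure \<mu> (if p \<in> B then space \<mu> else {})"
      using AE B sets.top[of \<mu>] by (intro emeasure_eq_AE) auto
    then show "emeasure \<mu> B = emeasure (return borel p) B"
      using B emeasure_space_1 by (simp add: sets_\<mu> indicator_def)
  qed (simp add: sets_\<mu>)
  then show thesis by (rule that)
qed

text \<open>The bound \<open>eigenvalue_le_capacity\<close> is used with \<Omega> the complement of
  a compact set \<open>L\<close>, whose measure may exceed 1/2; the factor 1 - \<mu>(\<Omega>) is
  then \<mu>(L).\<close>

lemma zero_capacity_null:
  assumes radon: "radon_measure \<mu>" and eig: "eigenvalue A g \<mu> 1 \<noteq> 0"
    and not_dirac: "\<And>p. \<mu> \<noteq> return borel p"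
    and E: "E \<in> sets borel" "zero_capacity A g E"
  shows "emeasure \<mu> E = 0"
proof (rule emeasure_eq_0_if_compact_null[OF radon E(1)])
  fix F assume F: "compact F" "F \<subseteq> E"
  have two: "prob K = 0 \<or> prob K = 1" if K: "compact K" "K \<subseteq> E" for K
  proof (rule disjCI)
    assume "prob K \<noteq> 1"
    have K_sets: "K \<in> sets \<mu>"
      using compact_imp_closed[OF K(1)] by (simp add: sets_\<mu>)
    then have "emeasure \<mu> (UNIV - K) \<noteq> 0"
      using \<open>prob K \<noteq> 1\<close> prob_compl[of K] by (simp add: emeasure_eq_measure space_\<mu>)
    \<comment> \<open>If \<open>K\<close> does not have full measure, inner regularity finds a
      compact set of positive measure in its complement.\<close>
    then obtain L where L: "compact L" "L \<subseteq> UNIV - K" "prob L \<noteq> 0"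
      using emeasure_eq_0_if_compact_null[OF radon, of "UNIV - K"] K_sets
      by (metis sets.compl_sets sets_\<mu> space_\<mu>)
    have L_sets: "L \<in> sets \<mu>"
      using compact_imp_closed[OF L(1)] by (simp add: sets_\<mu>)
    have L_open: "open (UNIV - L)" and "K \<subseteq> UNIV - L"
      using compact_imp_closed[OF L(1)] L(2) by auto
    then have "capacity A g K (UNIV - L) = 0"
      using E(2) K by (simp add: zero_capacity_def)
    then have "ennreal (prob K * (1 - prob (UNIV - L))) = 0"
      using eigenvalue_le_capacity[OF compact_imp_closed[OF K(1)] L_open \<open>K \<subseteq> UNIV - L\<close>] eig
      by simp
    moreover have "1 - prob (UNIV - L) = prob L"
      using prob_compl[OF L_sets] by (simp add: space_\<mu>)
    ultimately have "ennreal (prob K * prob L) = 0" by simp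
    then show "prob K = 0"
      using L(3) by (simp add: ennreal_eq_0_iff mult_le_0_iff measure_le_0_iff)
  qed
  show "prob F = 0"
  proof (rule ccontr)
    assume "prob F \<noteq> 0"
    then obtain p where "\<mu> = return borel p"
      using dirac_if_two_valued[OF radon F(1)] two F(2) by (metis subset_trans)
    with not_dirac show False by blast
  qed
qed

end

theorem corollary3p4:
  fixes A :: "'a::t2_space chart set"
    and c :: "'a metric set"
    and g :: "'a metric"
    and \<mu> :: "'a measure"
  assumes "compact_surface A"
    and "conformal_class A c"
    and "g \<in> c"
    and "radon_measure \<mu>"
    and "prob_space \<mu>"
  shows "(eigenvalue A g \<mu> 1 \<noteq> 0 \<longleftrightarrow>
           (\<exists>C::real. C > 0 \<and>
             (\<forall>F \<Omega>. closed F \<and> open \<Omega> \<and> F \<subseteq> \<Omega> \<and>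
                0 < measure \<mu> \<Omega> \<and> measure \<mu> \<Omega> \<le> 1 / 2 \<longrightarrow>
                emeasure \<mu> F \<le> ennreal C * capacity A g F \<Omega>))) \<and>
         (eigenvalue A g \<mu> 1 \<noteq> 0 \<and> (\<forall>p. \<mu> \<noteq> return borel p) \<longrightarrow>
           (\<forall>E\<in>sets borel. zero_capacity A g E \<longrightarrow> emeasure \<mu> E = 0))"
proof -
  interpret prob_space \<mu> by fact
  interpret surface_probability \<mu> A g
    using assms(1,4) by unfold_locales (auto simp: compact_surface_def radon_measure_def)
  show ?thesis
  proof (intro conjI iffI impI ballI)
    assume "eigenvalue A g \<mu> 1 \<noteq> 0"
    from capacity_inequality_if_eigenvalue_nonzero[OF this]
    show "\<exists>C::real. C > 0 \<and> (\<forall>F \<Omega>. closed F \<and> open \<Omega> \<and> F \<subseteq> \<Omega> \<and>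
        0 < measure \<mu> \<Omega> \<and> measure \<mu> \<Omega> \<le> 1 / 2 \<longrightarrow> emeasure \<mu> F \<le> ennreal C * capacity A g F \<Omega>)"
      by (elim exE conjE, intro exI conjI) (assumption, simp)
  next
    assume "\<exists>C::real. C > 0 \<and> (\<forall>F \<Omega>. closed F \<and> open \<Omega> \<and> F \<subseteq> \<Omega> \<and>
        0 < measure \<mu> \<Omega> \<and> measure \<mu> \<Omega> \<le> 1 / 2 \<longrightarrow> emeasure \<mu> F \<le> ennreal C * capacity A g F \<Omega>)"
    then show "eigenvalue A g \<mu> 1 \<noteq> 0"
      by (elim exE conjE, intro eigenvalue_nonzero_if_capacity_inequality) (assumption, simp)
  next
    fix E assume "eigenvalue A g \<mu> 1 \<noteq> 0 \<and> (\<forall>p. \<mu> \<noteq> return borel p)"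
      and "E \<in> sets borel" "zero_capacity A g E"
    then show "emeasure \<mu> E = 0"
      by (intro zero_capacity_null assms(4)) simp_all
  qed
qed

end
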